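(* Let $0<c_{\min}\le c_{\max}<\infty$, $q:=\frac{c_{\max}-c_{\min}}{c_{\max}+c_{\min}}$, $\alpha>0$ and $\omega_0>0$. There exist $\alpha_q\in(0,1)$ and $C>0$, independent of $\omega$, of the number $n$ of jumps and of the jump points, such that the following holds. Let $\omega\ge\omega_0$ and let $c$ be a piecewise constant wave speed on $\Omega=(-1,1)$ with values in $[c_{\min},c_{\max}]$, given by $c=c_j$ on $\tau_j=(x_{j-1},x_j)$, $1\le j\le n+1$, where $-1=x_0<x_1<\dots<x_{n+1}=1$, and assume that the number of jumps is bounded by $n\le\alpha\omega$. Then for all $g_1,g_2\in\mathbb{C}$ the solution $u$ of $$-u''-\left(\tfrac{\omega}{c}\right)^2u=0\ \text{ in }\Omega,\qquad -u'-\mathrm{i}\tfrac{\omega}{c_1}u=g_1\ \text{ at }x=-1,\qquad u'-\mathrm{i}\tfrac{\omega}{c_{n+1}}u=g_2\ \text{ at }x=1$$ satisfies $$\left(\int_\Omega|u'|^2+\left(\tfrac{\omega}{c}\right)^2|u|^2\right)^{1/2}\le C_{\mathrm{stab}}\left(|g_1|^2+|g_2|^2\right)^{1/2}\quad\text{with}\quad C_{\mathrm{stab}}\le C\,\alpha_q^{-\omega/c_{\min}}.$$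
   Context: The solution is the unique $u\in H^1(\Omega)$ with $$\int_\Omega\left(u'\bar v'-\left(\tfrac{\omega}{c}\right)^2u\bar v\right)-\mathrm{i}\sum_{x\in\{-1,1\}}\tfrac{\omega}{c(x)}u(x)\bar v(x)=g_1\bar v(-1)+g_2\bar v(1)\qquad\forall v\in H^1(\Omega),$$ where $c(-1)=c_1$, $c(1)=c_{n+1}$. *)

theory Defs
  imports "HOL-Analysis.Analysis"
begin

section \<open>Sobolev functions on an open set of reals\<close>

definition L2_on :: "real set \<Rightarrow> (real \<Rightarrow> complex) set" where
  "L2_on S = {u. u \<in> borel_measurable (lebesgue_on S) \<and>
                 integrable (lebesgue_on S) (\<lambda>t. (norm (u t))\<^sup>2)}"

definition test_function :: "real set \<Rightarrow> (real \<Rightarrow> real) \<Rightarrow> bool" where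
  "test_function S \<phi> \<longleftrightarrow>
     (\<forall>k t. (deriv ^^ k) \<phi> field_differentiable (at t)) \<and>
     compact (closure {t. \<phi> t \<noteq> 0}) \<and> closure {t. \<phi> t \<noteq> 0} \<subseteq> S"

text \<open>Real test functions suffice, since both sides of the defining identity extend
  complex-linearly to complex ones.\<close>

definition is_weak_deriv :: "real set \<Rightarrow> (real \<Rightarrow> complex) \<Rightarrow> (real \<Rightarrow> complex) \<Rightarrow> bool" where
  "is_weak_deriv S u u' \<longleftrightarrow>
     (\<forall>\<phi>. test_function S \<phi> \<longrightarrow>
        (LINT t|lebesgue_on S. u t * of_real (deriv \<phi> t)) =
        - (LINT t|lebesgue_on S. u' t * of_real (\<phi> t)))"

definition H1_on :: "real set \<Rightarrow> (real \<Rightarrow> complex) set" where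
  "H1_on S = {u \<in> L2_on S. \<exists>u' \<in> L2_on S. is_weak_deriv S u u'}"

text \<open>The weak derivative is unique up to null sets; below it occurs only under integrals.\<close>

definition weak_deriv :: "real set \<Rightarrow> (real \<Rightarrow> complex) \<Rightarrow> real \<Rightarrow> complex" where
  "weak_deriv S u = (SOME u'. u' \<in> L2_on S \<and> is_weak_deriv S u u')"

text \<open>Elements of \<^const>\<open>H1_on\<close> are arbitrary representatives, so a point value is that of the
  representative that is continuous up to the boundary; see \<open>boundary_trace_eqI\<close>.\<close>

definition boundary_trace :: "real set \<Rightarrow> (real \<Rightarrow> complex) \<Rightarrow> real \<Rightarrow> complex" where
  "boundary_trace S u p = (THE z. \<exists>w. continuous_on (closure S) w \<and>
                             (AE t in lebesgue_on S. w t = u t) \<and> w p = z)"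

lemma boundary_trace_eqI:
  assumes "open S" "p \<in> closure S" "continuous_on (closure S) w"
    and "AE t in lebesgue_on S. w t = u t"
  shows "boundary_trace S u p = w p"
  unfolding boundary_trace_def
proof (rule the_equality)
  show "\<exists>w'. continuous_on (closure S) w' \<and> (AE t in lebesgue_on S. w' t = u t) \<and> w' p = w p"
    using assms by blast
next
  fix z assume "\<exists>w'. continuous_on (closure S) w' \<and> (AE t in lebesgue_on S. w' t = u t) \<and> w' p = z"
  then obtain w' where w': "continuous_on (closure S) w'" "AE t in lebesgue_on S. w' t = u t"
    and z: "w' p = z" by blast
  define D where "D = {t \<in> S. w' t - w t \<in> - {0}}"
  have "continuous_on S (\<lambda>t. w' t - w t)"
    by (intro continuous_on_diff continuous_on_subset[OF w'(1)] continuous_on_subset[OF assms(3)]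
        closure_subset)
  then have "open D"
    using continuous_open_preimage[OF _ assms(1), of "\<lambda>t. w' t - w t" "- {0}"]
    by (simp add: D_def vimage_def Int_def open_Compl)
  have "AE t in lebesgue_on S. t \<notin> D"
    using w'(2) assms(4) by eventually_elim (auto simp: D_def)
  then have "AE t in lebesgue. t \<in> S \<longrightarrow> t \<notin> D"
    using assms(1) by (simp add: AE_restrict_space_iff)
  then have "AE t in lebesgue. t \<notin> D"
    by eventually_elim (auto simp: D_def)
  moreover have "D \<in> sets lebesgue"
    using \<open>open D\<close> by simp
  ultimately have "negligible D"
    by (simp add: negligible_iff_null_sets AE_iff_null_sets)
  then have "D = {}"
    using \<open>open D\<close> open_not_negligible by blast
  then have eq: "w' t = w t" if "t \<in> S" for t
    using that by (auto simp: D_def)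
  have "w' p - w p = 0"
    by (rule continuous_constant_on_closure[where f = "\<lambda>t. w' t - w t" and S = S])
      (auto intro!: continuous_on_diff w' assms simp: eq)
  then show "z = w p"
    using z by simp
qed


section \<open>The Helmholtz problem with piecewise constant wave speed\<close>

abbreviation \<Omega> :: "real set" where
  "\<Omega> \<equiv> {-1<..<1}"

text \<open>The values of \<open>c\<close> at the interior jump points are irrelevant and left unspecified, whereas
  those at the two end points enter the boundary conditions.\<close>

definition piecewise_constant_speed ::
  "real \<Rightarrow> real \<Rightarrow> nat \<Rightarrow> (nat \<Rightarrow> real) \<Rightarrow> (nat \<Rightarrow> real) \<Rightarrow> (real \<Rightarrow> real) \<Rightarrow> bool" where
  "piecewise_constant_speed cmin cmax n x cs c \<longleftrightarrow>
     x 0 = -1 \<and> x (n + 1) = 1 \<and>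
     (\<forall>j\<in>{1..n+1}. x (j - 1) < x j \<and> cs j \<in> {cmin..cmax} \<and>
        (\<forall>t\<in>{x (j - 1)<..<x j}. c t = cs j)) \<and>
     c (-1) = cs 1 \<and> c 1 = cs (n + 1)"

text \<open>Weak form of \<open>-u'' - (\<omega>/c)\<^sup>2 u = 0\<close> in \<open>\<Omega>\<close> with the impedance conditions
  \<open>-u' - \<i> (\<omega>/c) u = g1\<close> at \<open>-1\<close> and \<open>u' - \<i> (\<omega>/c) u = g2\<close> at \<open>1\<close>.\<close>

definition helmholtz_solution ::
  "real \<Rightarrow> (real \<Rightarrow> real) \<Rightarrow> complex \<Rightarrow> complex \<Rightarrow> (real \<Rightarrow> complex) \<Rightarrow> bool" where
  "helmholtz_solution \<omega> c g1 g2 u \<longleftrightarrow> u \<in> H1_on \<Omega> \<and>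
     (\<forall>v \<in> H1_on \<Omega>.
        (LINT t|lebesgue_on \<Omega>. weak_deriv \<Omega> u t * cnj (weak_deriv \<Omega> v t)
                                 - of_real ((\<omega> / c t)\<^sup>2) * u t * cnj (v t))
        - \<i> * (\<Sum>p\<in>{-1, 1}. of_real (\<omega> / c p) * boundary_trace \<Omega> u p * cnj (boundary_trace \<Omega> v p))
        = g1 * cnj (boundary_trace \<Omega> v (-1)) + g2 * cnj (boundary_trace \<Omega> v 1))"

definition energy_norm :: "real \<Rightarrow> (real \<Rightarrow> real) \<Rightarrow> (real \<Rightarrow> complex) \<Rightarrow> real" where
  "energy_norm \<omega> c u =
     sqrt (LINT t|lebesgue_on \<Omega>. (norm (weak_deriv \<Omega> u t))\<^sup>2 + (\<omega> / c t)\<^sup>2 * (norm (u t))\<^sup>2)"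

end

theory Submission
  imports Defs
begin

text \<open>Where the speed is constant, the energy density \<open>|u'|\<^sup>2 + (\<omega>/c)\<^sup>2 |u|\<^sup>2\<close> of a solution does not
  depend on the point, and since \<open>u\<close> and \<open>u'\<close> are continuous it grows at most by the factor
  \<open>(cmax/cmin)\<^sup>2\<close> across a jump; with \<open>n \<le> \<alpha>\<omega>\<close> jumps this is the claimed exponential growth. At
  the left end point the density is controlled by the data: the imaginary part of the weak form
  tested with \<open>u\<close> bounds the boundary values of \<open>u\<close>, and the impedance condition then bounds \<open>u'\<close>.\<close>


section \<open>Smooth bump functions\<close>

text \<open>The work lies in the continuity of u and u'. A solution is known only as some L2
  representative, its weak derivative as a choice up to null sets, its end values as those of a
  continuous version still to be produced. Two facts resolve this. A function with zero weak
  derivative is constant (du Bois-Reymond), so u agrees a.e. with a primitive U of its weak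
  derivative. The weak form then identifies that derivative a.e. with a continuous V for which V(t)
  = V(-1) minus the integral of (\<omega>/c)^2 U from -1 to t. The jumps of c stand under an
  integral there, so V stays continuous, and the transmission conditions at the jump points need no
  separate derivation. Explicit smooth bumps serve only to make \<open>test_function\<close> rich
  enough for these arguments. The speed contrast enters through \<rho> = cmax/cmin, which equals
  (1+q)/(1-q).\<close>

definition flat :: "real \<Rightarrow> real" where
  "flat t = (if t > 0 then exp (- 1 / t) else 0)"

lemma poly_over_exp_tendsto_0: "((\<lambda>y. poly p y / exp y) \<longlongrightarrow> (0::real)) at_top"
proof -
  have "((\<lambda>y. \<Sum>i\<le>degree p. coeff p i * (y ^ i / exp y)) \<longlongrightarrow> (\<Sum>i\<le>degree p. coeff p i * 0)) at_top"
    by (intro tendsto_sum tendsto_mult tendsto_const tendsto_power_div_exp_0)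
  then show ?thesis
    by (simp add: poly_altdef sum_divide_distrib)
qed

text \<open>With y = 1/t, differentiating p(y) exp(-y) gives y^2 (p(y) - p'(y)) exp(-y), again a
  polynomial in y times exp(-y). Keeping p arbitrary thus handles derivatives of every order at
  once, also at t = 0, where \<open>flat\<close> vanishes.\<close>

lemma DERIV_poly_inverse_flat:
  fixes p :: "real poly"
  shows "((\<lambda>t. poly p (1 / t) * flat t) has_real_derivative
     poly ([:0, 0, 1:] * (p - pderiv p)) (1 / t) * flat t) (at t)"
proof -
  consider "t > 0" | "t < 0" | "t = 0" by linarith
  then show ?thesis
  proof cases
    case 1
    have "((\<lambda>t. poly p (1 / t) * exp (- 1 / t)) has_real_derivative
       poly ([:0, 0, 1:] * (p - pderiv p)) (1 / t) * exp (- 1 / t)) (at t)"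
      using 1 by (auto intro!: derivative_eq_intros DERIV_chain'[OF _ poly_DERIV] simp: field_simps power2_eq_square)
    then have "((\<lambda>t. poly p (1 / t) * exp (- 1 / t)) has_real_derivative
       poly ([:0, 0, 1:] * (p - pderiv p)) (1 / t) * flat t) (at t)"
      using 1 by (simp add: flat_def)
    then show ?thesis
      by (rule has_field_derivative_transform_within_open[of _ _ _ "{0<..}"]) (use 1 in \<open>auto simp: flat_def\<close>)
  next
    case 2
    have "((\<lambda>t. 0) has_real_derivative 0) (at t)" by simp
    then have "((\<lambda>t. poly p (1 / t) * flat t) has_real_derivative 0) (at t)"
      by (rule has_field_derivative_transform_within_open[of _ _ _ "{..<0}"]) (use 2 in \<open>auto simp: flat_def\<close>)
    with 2 show ?thesis by (simp add: flat_def)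
  next
    case 3
    \<comment> \<open>The difference quotient at 0 divides by h, that is, multiplies by y = 1/h;
      \<open>pCons 0 p\<close> is this product y p(y).\<close>
    have "((\<lambda>h. poly (pCons 0 p) (inverse h) / exp (inverse h)) \<longlongrightarrow> 0) (at_right (0::real))"
      by (rule filterlim_compose[OF poly_over_exp_tendsto_0 filterlim_inverse_at_top_right])
    then have "((\<lambda>h. poly p (1 / h) * flat h / h) \<longlongrightarrow> 0) (at_right 0)"
      by (rule Lim_transform_eventually)
        (auto simp: eventually_at_right_less flat_def exp_minus field_simps
          intro!: eventually_mono[OF eventually_at_right_less[of 0]])
    moreover have "((\<lambda>h. poly p (1 / h) * flat h / h) \<longlongrightarrow> 0) (at_left 0)"
      by (rule Lim_transform_eventually[OF tendsto_const[of 0]])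
        (auto simp: flat_def eventually_at_left_real intro!: eventually_at_leftI[of "-1"])
    ultimately have "((\<lambda>h. poly p (1 / h) * flat h / h) \<longlongrightarrow> 0) (at 0)"
      by (simp add: filterlim_split_at)
    with 3 show ?thesis
      by (simp add: has_field_derivative_iff flat_def)
  qed
qed

text \<open>\<open>test_function\<close> asks for differentiability of all iterates of
  \<open>deriv\<close>. A class closed under differentiation settles that by one induction. Affine
  arguments with either sign of \<open>m\<close> provide both flanks of a bump.\<close>

inductive flat_algebra :: "(real \<Rightarrow> real) \<Rightarrow> bool" where
  base: "flat_algebra (\<lambda>t. poly p (1 / (m * t + d)) * flat (m * t + d))"
| const: "flat_algebra (\<lambda>t. r)"
| add: "flat_algebra f \<Longrightarrow> flat_algebra g \<Longrightarrow> flat_algebra (\<lambda>t. f t + g t)"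
| mult: "flat_algebra f \<Longrightarrow> flat_algebra g \<Longrightarrow> flat_algebra (\<lambda>t. f t * g t)"

lemma flat_algebra_deriv:
  "flat_algebra f \<Longrightarrow> \<exists>f'. flat_algebra f' \<and> (\<forall>t. (f has_real_derivative f' t) (at t))"
proof (induction rule: flat_algebra.induct)
  case (base p m d)
  let ?q = "[:0, 0, 1:] * (p - pderiv p)"
  have "((\<lambda>t. m * t + d) has_real_derivative m) (at t)" for t
    by (auto intro!: derivative_eq_intros)
  then have "((\<lambda>t. poly p (1 / (m * t + d)) * flat (m * t + d)) has_real_derivative
      (poly ?q (1 / (m * t + d)) * flat (m * t + d)) * m) (at t)" for t
    by (rule DERIV_chain'[OF _ DERIV_poly_inverse_flat])
  moreover have "flat_algebra (\<lambda>t. (poly ?q (1 / (m * t + d)) * flat (m * t + d)) * m)"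
    by (intro flat_algebra.intros)
  ultimately show ?case by blast
next
  case (const r)
  then show ?case using flat_algebra.const[of 0] by (intro exI[of _ "\<lambda>t. 0"]) auto
next
  case (add f g)
  then obtain f' g' where "flat_algebra f'" "flat_algebra g'"
    "\<And>t. (f has_real_derivative f' t) (at t)" "\<And>t. (g has_real_derivative g' t) (at t)" by blast
  then show ?case
    by (intro exI[of _ "\<lambda>t. f' t + g' t"]) (auto intro!: flat_algebra.intros derivative_intros)
next
  case (mult f g)
  then obtain f' g' where "flat_algebra f'" "flat_algebra g'"
    "\<And>t. (f has_real_derivative f' t) (at t)" "\<And>t. (g has_real_derivative g' t) (at t)" by blast
  with mult.hyps show ?case
    by (intro exI[of _ "\<lambda>t. f' t * g t + g' t * f t"])
      (auto intro!: flat_algebra.intros DERIV_mult)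
qed

lemma flat_algebra_smooth:
  assumes "flat_algebra f"
  shows "(deriv ^^ k) f field_differentiable (at t)"
proof -
  have "flat_algebra ((deriv ^^ k) f)"
  proof (induction k)
    case (Suc k)
    then obtain f' where "flat_algebra f'" "\<forall>t. ((deriv ^^ k) f has_real_derivative f' t) (at t)"
      using flat_algebra_deriv by blast
    moreover from this have "deriv ((deriv ^^ k) f) = f'"
      by (intro ext DERIV_imp_deriv) blast
    ultimately show ?case by simp
  qed (use assms in simp)
  then show ?thesis
    using flat_algebra_deriv field_differentiable_def by blast
qed

text \<open>The parameter \<open>m\<close> is the steepness: the support stays fixed, while for m
  tending to infinity the values increase to 1 inside the interval.\<close>

definition bump :: "real \<Rightarrow> real \<Rightarrow> real \<Rightarrow> real \<Rightarrow> real" where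
  "bump m a b t = flat (m * (t - a)) * flat (m * (b - t))"

lemma bump_eq_0: "m > 0 \<Longrightarrow> t \<notin> {a<..<b} \<Longrightarrow> bump m a b t = 0"
  by (auto simp: bump_def flat_def zero_less_mult_iff)

lemma bump_pos: "m > 0 \<Longrightarrow> t \<in> {a<..<b} \<Longrightarrow> bump m a b t > 0"
  by (auto simp: bump_def flat_def zero_less_mult_iff)

lemma bump_nonneg: "bump m a b t \<ge> 0"
  by (auto simp: bump_def flat_def)

lemma bump_le_1: "bump m a b t \<le> 1"
  unfolding bump_def by (rule mult_le_one) (auto simp: flat_def)

lemma bump_tendsto_indicator:
  "(\<lambda>i. bump (real (Suc i)) a b t) \<longlonglongrightarrow> indicator {a<..<b} t"
proof (cases "t \<in> {a<..<b}")
  case True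
  have *: "(\<lambda>i. exp (- 1 / (real (Suc i) * d))) \<longlonglongrightarrow> 1" if "d > 0" for d
  proof -
    have "(\<lambda>i. exp (- (1 / d) * (1 / real (Suc i)))) \<longlonglongrightarrow> exp (- (1 / d) * 0)"
      by (intro tendsto_intros LIMSEQ_Suc[OF lim_1_over_n])
    then show ?thesis by (simp add: field_simps)
  qed
  have "bump (real (Suc i)) a b t
      = exp (- 1 / (real (Suc i) * (t - a))) * exp (- 1 / (real (Suc i) * (b - t)))" for i
    using True unfolding bump_def flat_def
    by (auto simp: zero_less_mult_iff simp del: of_nat_Suc)
  then show ?thesis
    using True tendsto_mult[OF *[of "t - a"] *[of "b - t"]] by simp
next
  case False
  then show ?thesis by (simp add: bump_eq_0)
qed

lemma test_functionI:
  assumes "\<And>k t. (deriv ^^ k) f field_differentiable (at t)"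
    and "\<And>t. t \<notin> {a..b} \<Longrightarrow> f t = 0" and "{a..b} \<subseteq> S"
  shows "test_function S f"
proof -
  have "{t. f t \<noteq> 0} \<subseteq> {a..b}"
    using assms(2) by blast
  then have "closure {t. f t \<noteq> 0} \<subseteq> {a..b}"
    by (intro closure_minimal) auto
  moreover from this have "compact (closure {t. f t \<noteq> 0})"
    by (meson bounded_closed_interval bounded_subset closed_closure compact_eq_bounded_closed)
  ultimately show ?thesis
    using assms unfolding test_function_def by auto
qed

lemma flat_algebra_bump: "flat_algebra (bump m a b)"
proof -
  have "flat_algebra (\<lambda>t. poly 1 (1 / (m * t + (- m * a))) * flat (m * t + (- m * a))
      * (poly 1 (1 / (- m * t + m * b)) * flat (- m * t + m * b)))"
    by (intro flat_algebra.intros)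
  then show ?thesis
    by (simp add: bump_def[abs_def] algebra_simps)
qed

lemma test_function_bump:
  assumes "m > 0" "{a..b} \<subseteq> S"
  shows "test_function S (bump m a b)"
proof (rule test_functionI[OF _ _ assms(2)])
  show "(deriv ^^ k) (bump m a b) field_differentiable at t" for k t
    by (rule flat_algebra_smooth[OF flat_algebra_bump])
  show "bump m a b t = 0" if "t \<notin> {a..b}" for t
    using that assms(1) by (intro bump_eq_0) auto
qed

text \<open>The iterates of \<open>deriv\<close> on \<phi> are those on \<psi> shifted by one, so
  only differentiability of \<phi> itself is added.\<close>

lemma test_function_antiderivative:
  assumes smooth: "\<And>k t. (deriv ^^ k) \<psi> field_differentiable (at t)"
    and der: "\<And>t. (\<phi> has_real_derivative \<psi> t) (at t)"
    and "\<And>t. t \<notin> {a..b} \<Longrightarrow> \<phi> t = 0" and "{a..b} \<subseteq> S"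
  shows "test_function S \<phi>"
proof (rule test_functionI[OF _ assms(3,4)])
  have eq: "deriv \<phi> = \<psi>"
    using der by (auto intro: DERIV_imp_deriv)
  fix k t
  show "(deriv ^^ k) \<phi> field_differentiable at t"
    using der smooth
    by (cases k) (auto simp: field_differentiable_def funpow_Suc_right eq simp del: funpow.simps)
qed


section \<open>Integration on the interval\<close>

lemma lmeasurable_\<Omega> [simp]: "\<Omega> \<in> lmeasurable" "\<Omega> \<in> sets lebesgue"
  by auto

text \<open>The bridge between two integrals: the weak form is stated with the Bochner integral,
  while primitives and the fundamental theorem of calculus use the gauge integral over closed
  intervals.\<close>

lemma integral_lebesgue_on_\<Omega>:
  fixes f :: "real \<Rightarrow> complex"
  assumes "integrable (lebesgue_on \<Omega>) f"
  shows "(LINT t|lebesgue_on \<Omega>. f t) = integral {-1..1} f"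
  using assms by (simp add: lebesgue_integral_eq_integral integral_open_interval_real)

lemma integrable_on_of_\<Omega>:
  fixes f :: "real \<Rightarrow> complex"
  assumes "integrable (lebesgue_on \<Omega>) f" "-1 \<le> a" "b \<le> 1"
  shows "f integrable_on {a..b}"
proof -
  have "f integrable_on \<Omega>"
    using assms by (intro integrable_on_lebesgue_on) auto
  then have "f integrable_on {-1..1}"
    by (simp add: integrable_on_open_interval_real)
  then show ?thesis
    by (rule integrable_subinterval_real) (use assms in auto)
qed

lemma integrable_indicator_mult:
  fixes f :: "real \<Rightarrow> complex"
  assumes "integrable (lebesgue_on \<Omega>) f" "A \<in> sets borel"
  shows "integrable (lebesgue_on \<Omega>) (\<lambda>t. indicator A t * f t)"
proof (rule Bochner_Integration.integrable_bound[OF assms(1)])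
  have "indicator A \<in> borel_measurable (lebesgue_on \<Omega>)"
    using assms(2) by (intro measurable_restrict_space1 borel_measurable_indicator) auto
  then show "(\<lambda>t. indicator A t * f t) \<in> borel_measurable (lebesgue_on \<Omega>)"
    using borel_measurable_integrable[OF assms(1)] by measurable
qed (auto simp: indicator_def)

lemma integral_indicator_\<Omega>:
  fixes f :: "real \<Rightarrow> complex"
  assumes "integrable (lebesgue_on \<Omega>) f" "-1 \<le> a" "b \<le> 1"
  shows "(LINT t|lebesgue_on \<Omega>. indicator {a<..<b} t * f t) = integral {a..b} f"
proof -
  have "(LINT t|lebesgue_on \<Omega>. indicator {a<..<b} t * f t) = integral \<Omega> (\<lambda>t. indicator {a<..<b} t * f t)"
    using assms by (intro lebesgue_integral_eq_integral integrable_indicator_mult) auto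
  also have "\<dots> = integral \<Omega> (\<lambda>t. if t \<in> {a<..<b} then f t else 0)"
    by (intro integral_cong) auto
  also have "\<dots> = integral {a<..<b} f"
    using assms by (subst integral_restrict_Int) (auto intro!: arg_cong2[of _ _ _ _ integral])
  finally show ?thesis
    by (simp add: integral_open_interval_real)
qed

text \<open>Both sides are the integral of f(t) g(s) over the triangle t < s, so this is Fubini. It
  plays the part of integration by parts for functions that are merely integrable.\<close>

lemma integral_swap_primitives:
  fixes f g :: "real \<Rightarrow> complex"
  assumes f: "integrable (lebesgue_on \<Omega>) f" and g: "integrable (lebesgue_on \<Omega>) g"
  shows "(LINT t|lebesgue_on \<Omega>. f t * integral {t..1} g)
       = (LINT s|lebesgue_on \<Omega>. g s * integral {-1..s} f)"
proof -
  let ?M = "lebesgue_on \<Omega>"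
  interpret finite_measure ?M
    by (rule finite_measure_lebesgue_on) simp
  interpret pair_sigma_finite ?M ?M ..
  note [measurable] = borel_measurable_integrable[OF f] borel_measurable_integrable[OF g]
  have id [measurable]: "(\<lambda>t. t) \<in> borel_measurable ?M"
    by (intro measurable_restrict_space1 measurable_completion) auto
  define h where "h t s = f t * (if t < s then g s else 0)" for t s
  have [measurable]: "case_prod h \<in> borel_measurable (?M \<Otimes>\<^sub>M ?M)"
    unfolding h_def case_prod_beta' by measurable
  have int: "integrable ?M (h t)" if "t \<in> \<Omega>" for t
  proof (rule Bochner_Integration.integrable_bound[of _ "\<lambda>s. f t * g s"])
    show "h t \<in> borel_measurable ?M"
      unfolding h_def by measurable
  qed (use g in \<open>auto simp: h_def\<close>)
  have "integrable (?M \<Otimes>\<^sub>M ?M) (case_prod h)"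
  proof (rule Fubini_integrable)
    show "integrable ?M (\<lambda>t. LINT s|?M. norm (case_prod h (t, s)))"
    proof (rule Bochner_Integration.integrable_bound)
      show "integrable ?M (\<lambda>t. norm (f t) * (LINT s|?M. norm (g s)))"
        using f by auto
      show "(\<lambda>t. LINT s|?M. norm (case_prod h (t, s))) \<in> borel_measurable ?M"
        by measurable
      show "AE t in ?M. norm (LINT s|?M. norm (case_prod h (t, s)))
          \<le> norm (norm (f t) * (LINT s|?M. norm (g s)))"
      proof (rule AE_I2)
        fix t assume "t \<in> space ?M"
        then have "(LINT s|?M. norm (h t s)) \<le> (LINT s|?M. norm (f t) * norm (g s))"
          using g by (intro integral_mono integrable_norm int) (auto simp: h_def norm_mult)
        then show "norm (LINT s|?M. norm (case_prod h (t, s)))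
          \<le> norm (norm (f t) * (LINT s|?M. norm (g s)))"
          by simp
      qed
    qed
    show "AE t in ?M. integrable ?M (\<lambda>s. case_prod h (t, s))"
      by (rule AE_I2) (simp add: int[simplified])
  qed simp
  from Fubini_integral[OF this]
  have "(LINT s|?M. LINT t|?M. h t s) = (LINT t|?M. LINT s|?M. h t s)" .
  moreover have "(LINT s|?M. LINT t|?M. h t s) = (LINT s|?M. g s * integral {-1..s} f)"
  proof (rule Bochner_Integration.integral_cong[OF refl])
    fix s assume "s \<in> space ?M"
    then have *: "s \<in> \<Omega>" by simp
     have "(LINT t|?M. h t s) = (LINT t|?M. g s * (indicator {-1<..<s} t * f t))"
      by (rule Bochner_Integration.integral_cong) (auto simp: h_def indicator_def)
    then show "(LINT t|?M. h t s) = g s * integral {-1..s} f"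
      using integral_indicator_\<Omega>[OF f, of "-1" s] * by simp
  qed
  moreover have "(LINT t|?M. LINT s|?M. h t s) = (LINT t|?M. f t * integral {t..1} g)"
  proof (rule Bochner_Integration.integral_cong[OF refl])
    fix t assume "t \<in> space ?M"
    then have *: "t \<in> \<Omega>" by simp
    have "(LINT s|?M. h t s) = (LINT s|?M. f t * (indicator {t<..<1} s * g s))"
      by (rule Bochner_Integration.integral_cong) (auto simp: h_def indicator_def)
    then show "(LINT s|?M. h t s) = f t * integral {t..1} g"
      using integral_indicator_\<Omega>[OF g, of t 1] * by simp
  qed
  ultimately show ?thesis
    by simp
qed

lemma integrable_L2_on:
  assumes "u \<in> L2_on \<Omega>"
  shows "integrable (lebesgue_on \<Omega>) u"
proof (rule Bochner_Integration.integrable_bound)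
  interpret finite_measure "lebesgue_on \<Omega>"
    by (rule finite_measure_lebesgue_on) simp
  show "integrable (lebesgue_on \<Omega>) (\<lambda>t. 1 + (norm (u t))\<^sup>2)"
    using assms by (auto simp: L2_on_def)
  show "u \<in> borel_measurable (lebesgue_on \<Omega>)"
    using assms by (auto simp: L2_on_def)
  have "r \<le> 1 + r\<^sup>2" for r :: real
    using sum_power2_ge_zero[of "r - 1/2" 0] by (simp add: power2_eq_square algebra_simps)
  then show "AE t in lebesgue_on \<Omega>. norm (u t) \<le> norm (1 + (norm (u t))\<^sup>2)"
    by (auto simp: abs_of_nonneg)
qed

lemma L2_onI_bounded:
  assumes [measurable]: "u \<in> borel_measurable (lebesgue_on \<Omega>)" and "\<And>t. t \<in> \<Omega> \<Longrightarrow> norm (u t) \<le> B"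
  shows "u \<in> L2_on \<Omega>"
proof -
  interpret finite_measure "lebesgue_on \<Omega>"
    by (rule finite_measure_lebesgue_on) simp
  have "integrable (lebesgue_on \<Omega>) (\<lambda>t. (norm (u t))\<^sup>2)"
    by (rule Bochner_Integration.integrable_bound[of _ "\<lambda>t. B\<^sup>2"])
      (auto intro!: AE_I2 power_mono assms(2))
  then show ?thesis by (simp add: L2_on_def)
qed

lemma integrable_mult_bounded_\<Omega>:
  fixes f v :: "real \<Rightarrow> complex"
  assumes f: "integrable (lebesgue_on \<Omega>) f" and v: "v \<in> borel_measurable (lebesgue_on \<Omega>)"
    and "AE t in lebesgue_on \<Omega>. norm (v t) \<le> B"
  shows "integrable (lebesgue_on \<Omega>) (\<lambda>t. f t * v t)"
proof (rule Bochner_Integration.integrable_bound[of _ "\<lambda>t. of_real B * f t"])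
  show "(\<lambda>t. f t * v t) \<in> borel_measurable (lebesgue_on \<Omega>)"
    using borel_measurable_integrable[OF f] v by measurable
  show "AE t in lebesgue_on \<Omega>. norm (f t * v t) \<le> norm (of_real B * f t)"
    using assms(3)
  proof eventually_elim
    case (elim t)
    then have "norm (v t) \<le> \<bar>B\<bar>" by linarith
    then show ?case
      by (simp add: norm_mult mult.commute[of "\<bar>B\<bar>"] mult_left_mono)
  qed
qed (use f in auto)

lemma continuous_imp_measurable_\<Omega>:
  fixes v :: "real \<Rightarrow> 'a :: real_normed_vector"
  assumes "continuous_on \<Omega> v"
  shows "v \<in> borel_measurable (lebesgue_on \<Omega>)"
  using assms by (rule continuous_imp_measurable_on_sets_lebesgue) simp

section \<open>The fundamental lemma of the calculus of variations\<close>

text \<open>Lebesgue differentiation: at almost every t, f(t) is the limit of the means over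
  [t, t+h], and these vanish.\<close>

lemma AE_zero_if_interval_integrals_zero:
  fixes f :: "real \<Rightarrow> complex"
  assumes f: "integrable (lebesgue_on \<Omega>) f"
    and z: "\<And>a b. -1 < a \<Longrightarrow> a < b \<Longrightarrow> b < 1 \<Longrightarrow> integral {a..b} f = 0"
  shows "AE t in lebesgue_on \<Omega>. f t = 0"
proof -
  define F where "F t = (if t \<in> \<Omega> then f t else 0)" for t
  have "f integrable_on \<Omega>"
    using f by (intro integrable_on_lebesgue_on) auto
  then have "F integrable_on UNIV"
    unfolding F_def by (subst integrable_restrict_UNIV)
  then have "F integrable_on cbox a b" for a b
    by (rule integrable_on_subcbox) auto
  then obtain N where N: "negligible N"
    and lim: "\<And>x e. \<lbrakk>x \<notin> N; 0 < e\<rbrakk> \<Longrightarrow>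
       \<exists>d>0. \<forall>h. 0 < h \<and> h < d \<longrightarrow> norm (integral (cbox x (x + h *\<^sub>R One)) F /\<^sub>R h ^ DIM(real) - F x) < e"
    by (rule integrable_ccontinuous_explicit) blast
  have "f t = 0" if t: "t \<notin> N" "t \<in> \<Omega>" for t
  proof (rule ccontr)
    assume "f t \<noteq> 0"
    then obtain d where d: "d > 0"
      "\<And>h. 0 < h \<Longrightarrow> h < d \<Longrightarrow> norm (integral {t..t + h} F /\<^sub>R h - F t) < norm (f t)"
      using lim[OF t(1), of "norm (f t)"] by auto
    \<comment> \<open>The bound by (1 - t)/2 keeps [t, t+h] inside \<Omega>, where \<open>F\<close>
      agrees with \<open>f\<close> and \<open>z\<close> applies.\<close>
    define h where "h = min (d / 2) ((1 - t) / 2)"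
    have h: "0 < h" "h < d" "t + h < 1"
      using d(1) t(2) by (auto simp: h_def min_def field_simps)
    have "integral {t..t + h} F = integral {t..t + h} f"
      by (rule integral_cong) (use t h in \<open>auto simp: F_def\<close>)
    also have "\<dots> = 0"
      using t h by (intro z) auto
    finally show False
      using d(2)[OF h(1,2)] t by (simp add: F_def)
  qed
  then have "{t. \<not> (t \<in> \<Omega> \<longrightarrow> f t = 0)} \<subseteq> N"
    by blast
  then have "negligible {t. \<not> (t \<in> \<Omega> \<longrightarrow> f t = 0)}"
    using N negligible_subset by blast
  then have "AE t in lebesgue. t \<in> \<Omega> \<longrightarrow> f t = 0"
    by (intro AE_I'[of "{t. \<not> (t \<in> \<Omega> \<longrightarrow> f t = 0)}"]) (auto simp: negligible_iff_null_sets)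
  then show ?thesis
    by (simp add: AE_restrict_space_iff)
qed

lemma continuous_of_real_test_function:
  assumes "test_function S \<phi>"
  shows "continuous_on A (\<lambda>t. complex_of_real (\<phi> t))"
proof -
  have "(\<phi> has_real_derivative deriv \<phi> t) (at t)" for t
    using assms DERIV_deriv_iff_field_differentiable
    unfolding test_function_def by (metis funpow_0)
  then have "continuous_on A \<phi>"
    using DERIV_isCont continuous_at_imp_continuous_on by blast
  then show ?thesis by (intro continuous_intros)
qed

text \<open>Bumps of growing steepness converge to the indicator of their interval and are at most
  1, so dominated convergence with majorant |f| reduces the claim to interval integrals.\<close>

lemma AE_zero_if_test_integrals_zero:
  fixes f :: "real \<Rightarrow> complex"
  assumes f: "integrable (lebesgue_on \<Omega>) f"
    and z: "\<And>a b m. -1 < a \<Longrightarrow> a < b \<Longrightarrow> b < 1 \<Longrightarrow> 0 < m \<Longrightarrow>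
              (LINT t|lebesgue_on \<Omega>. f t * of_real (bump m a b t)) = 0"
  shows "AE t in lebesgue_on \<Omega>. f t = 0"
proof (rule AE_zero_if_interval_integrals_zero[OF f])
  fix a b :: real
  assume ab: "-1 < a" "a < b" "b < 1"
  let ?s = "\<lambda>i t. f t * of_real (bump (real (Suc i)) a b t)"
  have fm [measurable]: "f \<in> borel_measurable (lebesgue_on \<Omega>)"
    using f by auto
  have "(\<lambda>i. LINT t|lebesgue_on \<Omega>. ?s i t) \<longlonglongrightarrow> (LINT t|lebesgue_on \<Omega>. indicator {a<..<b} t * f t)"
  proof (rule integral_dominated_convergence)
    show "(\<lambda>t. indicator {a<..<b} t * f t) \<in> borel_measurable (lebesgue_on \<Omega>)"
      using integrable_indicator_mult[OF f, of "{a<..<b}"] by auto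
    show "?s i \<in> borel_measurable (lebesgue_on \<Omega>)" for i
      using fm continuous_imp_measurable_\<Omega>[OF continuous_of_real_test_function[OF test_function_bump[of "real (Suc i)" a b UNIV]]]
      by measurable
    show "integrable (lebesgue_on \<Omega>) (\<lambda>t. norm (f t))"
      using f by auto
    show "AE t in lebesgue_on \<Omega>. (\<lambda>i. ?s i t) \<longlonglongrightarrow> indicator {a<..<b} t * f t"
    proof (rule AE_I2)
      fix t
      have "(\<lambda>i. ?s i t) \<longlonglongrightarrow> f t * of_real (indicator {a<..<b} t)"
        by (intro tendsto_mult tendsto_const tendsto_of_real bump_tendsto_indicator)
      then show "(\<lambda>i. ?s i t) \<longlonglongrightarrow> indicator {a<..<b} t * f t"
        by (cases "t \<in> {a<..<b}") simp_all
    qed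
    show "AE t in lebesgue_on \<Omega>. norm (?s i t) \<le> norm (f t)" for i
      using bump_le_1 bump_nonneg by (auto simp: norm_mult mult_left_le)
  qed
  moreover have "(LINT t|lebesgue_on \<Omega>. ?s i t) = 0" for i
    using ab by (intro z) auto
  ultimately show "integral {a..b} f = 0"
    using integral_indicator_\<Omega>[OF f, of a b] ab by (simp add: LIMSEQ_const_iff)
qed


section \<open>Weak derivatives\<close>

lemma test_function_has_vector_derivative:
  assumes "test_function S \<phi>"
  shows "((\<lambda>t. complex_of_real (\<phi> t)) has_vector_derivative of_real (deriv \<phi> t)) (at t within A)"
proof -
  have "(\<phi> has_real_derivative deriv \<phi> t) (at t within A)"
    using assms DERIV_deriv_iff_field_differentiable has_field_derivative_at_within
    unfolding test_function_def by (metis funpow_0)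
  then show ?thesis
    by (intro has_vector_derivative_of_real) (simp add: has_real_derivative_iff_has_vector_derivative)
qed

lemma continuous_of_real_deriv_test_function:
  assumes "test_function S \<phi>"
  shows "continuous_on A (\<lambda>t. complex_of_real (deriv \<phi> t))"
proof -
  have "deriv \<phi> field_differentiable (at t)" for t
    using assms unfolding test_function_def by (metis funpow_0 funpow.simps(2) comp_apply)
  then have "continuous_on A (deriv \<phi>)"
    using field_differentiable_imp_continuous_at continuous_at_imp_continuous_on by blast
  then show ?thesis by (intro continuous_intros)
qed

lemma test_function_eq_0:
  assumes "test_function S \<phi>" "t \<notin> S"
  shows "\<phi> t = 0"
  using assms closure_subset[of "{t. \<phi> t \<noteq> 0}"] unfolding test_function_def by blast

lemma integral_deriv_test_function:
  assumes "test_function S \<phi>" "a \<le> b"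
  shows "integral {a..b} (\<lambda>t. complex_of_real (deriv \<phi> t)) = of_real (\<phi> b) - of_real (\<phi> a)"
  using assms by (intro integral_unique fundamental_theorem_of_calculus test_function_has_vector_derivative)

lemma continuous_bounded_\<Omega>:
  fixes v :: "real \<Rightarrow> complex"
  assumes "continuous_on {-1..1} v"
  shows "\<exists>B. \<forall>t\<in>\<Omega>. norm (v t) \<le> B"
proof -
  have "bounded (v ` {-1..1})"
    using assms by (intro compact_imp_bounded compact_continuous_image) auto
  then obtain B where "\<forall>y \<in> v ` {-1..1}. norm y \<le> B"
    unfolding bounded_iff by blast
  then show ?thesis by (intro exI[of _ B]) force
qed

lemma integrable_mult_continuous_\<Omega>:
  fixes f v :: "real \<Rightarrow> complex"
  assumes f: "integrable (lebesgue_on \<Omega>) f" and v: "continuous_on {-1..1} v"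
  shows "integrable (lebesgue_on \<Omega>) (\<lambda>t. f t * v t)"
proof -
  obtain B where "\<forall>t\<in>\<Omega>. norm (v t) \<le> B"
    using continuous_bounded_\<Omega>[OF v] by blast
  moreover have "continuous_on \<Omega> v"
    using v by (rule continuous_on_subset) auto
  ultimately show ?thesis
    by (intro integrable_mult_bounded_\<Omega>[OF f, of _ B] continuous_imp_measurable_\<Omega>) auto
qed

lemma integrable_continuous_\<Omega>:
  fixes v :: "real \<Rightarrow> complex"
  assumes v: "continuous_on {-1..1} v"
  shows "integrable (lebesgue_on \<Omega>) v"
proof -
  interpret finite_measure "lebesgue_on \<Omega>"
    by (rule finite_measure_lebesgue_on) simp
  show ?thesis
    using integrable_mult_continuous_\<Omega>[OF integrable_const[of "1 :: complex"] v] by simp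
qed

lemma continuous_L2_on:
  fixes v :: "real \<Rightarrow> complex"
  assumes v: "continuous_on {-1..1} v"
  shows "v \<in> L2_on \<Omega>"
proof -
  obtain B where "\<forall>t\<in>\<Omega>. norm (v t) \<le> B"
    using continuous_bounded_\<Omega>[OF v] by blast
  moreover have "continuous_on \<Omega> v"
    using v by (rule continuous_on_subset) auto
  ultimately show ?thesis
    by (intro L2_onI_bounded[of _ B] continuous_imp_measurable_\<Omega>) auto
qed

text \<open>Makes the choice hidden in \<open>weak_deriv\<close> harmless: whenever a weak
  derivative can be exhibited, the chosen one agrees with it a.e.\<close>

lemma weak_deriv_AE_unique:
  assumes f: "integrable (lebesgue_on \<Omega>) f" and g: "integrable (lebesgue_on \<Omega>) g"
    and "is_weak_deriv \<Omega> u f" "is_weak_deriv \<Omega> u g"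
  shows "AE t in lebesgue_on \<Omega>. f t = g t"
proof -
  have "AE t in lebesgue_on \<Omega>. f t - g t = 0"
  proof (rule AE_zero_if_test_integrals_zero)
    fix a b m :: real
    assume "-1 < a" "a < b" "b < 1" "0 < m"
    then have \<phi>: "test_function \<Omega> (bump m a b)"
      by (intro test_function_bump) auto
    note [intro] = integrable_mult_continuous_\<Omega>[OF _ continuous_of_real_test_function[OF \<phi>]]
    have "(LINT t|lebesgue_on \<Omega>. (f t - g t) * of_real (bump m a b t))
        = (LINT t|lebesgue_on \<Omega>. f t * of_real (bump m a b t))
          - (LINT t|lebesgue_on \<Omega>. g t * of_real (bump m a b t))"
      using f g by (subst Bochner_Integration.integral_diff[symmetric]) (auto simp: left_diff_distrib)
    also have "\<dots> = 0"
      using assms(3,4)[unfolded is_weak_deriv_def, rule_format, OF \<phi>] by simp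
    finally show "(LINT t|lebesgue_on \<Omega>. (f t - g t) * of_real (bump m a b t)) = 0" .
  qed (use f g in auto)
  then show ?thesis by simp
qed

lemma continuous_primitive:
  fixes w :: "real \<Rightarrow> complex"
  assumes "integrable (lebesgue_on \<Omega>) w"
  shows "continuous_on {-1..1} (\<lambda>t. integral {-1..t} w)"
  using assms by (intro indefinite_integral_continuous_1 integrable_on_of_\<Omega>) auto

text \<open>Exchanging the order of integration replaces the primitive of w by the integral of
  \<phi>' from t to 1, which is -\<phi>(t) since \<phi>(1) = 0. The constant drops out because
  \<phi> vanishes at both ends.\<close>

lemma is_weak_deriv_primitive:
  assumes w: "integrable (lebesgue_on \<Omega>) w"
  shows "is_weak_deriv \<Omega> (\<lambda>t. K + integral {-1..t} w) w"
  unfolding is_weak_deriv_def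
proof (intro allI impI)
  fix \<phi> assume \<phi>: "test_function \<Omega> \<phi>"
  let ?d = "\<lambda>t. complex_of_real (deriv \<phi> t)"
  have d: "integrable (lebesgue_on \<Omega>) ?d"
    by (intro integrable_continuous_\<Omega> continuous_of_real_deriv_test_function[OF \<phi>])
  have 1: "(LINT t|lebesgue_on \<Omega>. K * ?d t) = 0"
    using integral_lebesgue_on_\<Omega>[OF d] integral_deriv_test_function[OF \<phi>, of "-1" 1]
      test_function_eq_0[OF \<phi>, of 1] test_function_eq_0[OF \<phi>, of "-1"] by simp
  have "(LINT t|lebesgue_on \<Omega>. (K + integral {-1..t} w) * ?d t)
      = (LINT t|lebesgue_on \<Omega>. K * ?d t + ?d t * integral {-1..t} w)"
    by (simp add: algebra_simps)
  also have "\<dots> = (LINT t|lebesgue_on \<Omega>. K * ?d t) + (LINT t|lebesgue_on \<Omega>. ?d t * integral {-1..t} w)"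
    by (intro Bochner_Integration.integral_add integrable_mult_right integrable_mult_continuous_\<Omega>
        continuous_primitive w d)
  also have "\<dots> = (LINT t|lebesgue_on \<Omega>. w t * integral {t..1} ?d)"
    using integral_swap_primitives[OF w d] 1 by simp
  also have "\<dots> = (LINT t|lebesgue_on \<Omega>. - (w t * of_real (\<phi> t)))"
    by (rule Bochner_Integration.integral_cong[OF refl])
      (use test_function_eq_0[OF \<phi>, of 1] in \<open>auto simp: integral_deriv_test_function[OF \<phi>]\<close>)
  finally show "(LINT t|lebesgue_on \<Omega>. (K + integral {-1..t} w) * ?d t)
      = - (LINT t|lebesgue_on \<Omega>. w t * of_real (\<phi> t))"
    by simp
qed

section \<open>The lemma of du Bois-Reymond\<close>

text \<open>A smooth function with compact support in \<Omega> is the derivative of a test function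
  once its mean vanishes, for then its primitive returns to zero beyond the support. The second bump
  is a fixed reference whose multiple will cancel the mean.\<close>

lemma bump_difference_antiderivative:
  fixes a b m r :: real
  defines "g \<equiv> \<lambda>t. bump m a b t - r * bump 1 (-1/2) (1/2) t"
  assumes ab: "-1 < a" "a < b" "b < 1" "0 < m"
    and zero: "integral {-1..1} g = 0"
  obtains \<phi> where "test_function \<Omega> \<phi>" "deriv \<phi> = g"
proof
  define \<phi> where "\<phi> t = integral {-1..t} g" for t
  \<comment> \<open>\<open>{a0..b0}\<close> is the hull of both supports and still lies strictly
    inside \<Omega>.\<close>
  define a0 where "a0 = min a (-1/2)"
  define b0 where "b0 = max b (1/2)"
  have g0: "g t = 0" if "t \<notin> {a0<..<b0}" for t
  proof -
    have "t \<notin> {a<..<b}" "t \<notin> {-1/2<..<1/2}"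
      using that by (auto simp: a0_def b0_def)
    then show ?thesis
      using ab unfolding g_def by (simp add: bump_eq_0 del: greaterThanLessThan_iff)
  qed
  have "flat_algebra (\<lambda>t. bump m a b t + (- r) * bump 1 (-1/2) (1/2) t)"
    by (intro flat_algebra.add flat_algebra.mult flat_algebra.const flat_algebra_bump)
  then have g: "flat_algebra g"
    by (simp add: g_def)
  have cont: "continuous_on A g" for A
    using flat_algebra_smooth[OF g, of 0] field_differentiable_imp_continuous_at
      continuous_at_imp_continuous_on by (metis funpow_0)
  have below: "\<phi> t = 0" if "t < a0" for t
    unfolding \<phi>_def using that by (intro integral_unique has_integral_is_0) (auto simp: g0)
  have der: "(\<phi> has_real_derivative g t) (at t)" for t
  proof (cases "t < a0")
    case True
    have "(\<phi> has_real_derivative 0) (at t)"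
      by (rule has_field_derivative_transform_within_open[of "\<lambda>_. 0" _ _ "{..<a0}"])
        (use True in \<open>auto simp: below\<close>)
    then show ?thesis using True by (simp add: g0)
  next
    case False
    \<comment> \<open>The primitive starts at -1, so t is interior to \<open>{-1..t+1}\<close> and
      the derivative within that interval is the full one.\<close>
    then have "-1 < t" using ab by (auto simp: a0_def)
    then have "(\<phi> has_real_derivative g t) (at t within {-1..t+1})"
      unfolding \<phi>_def by (intro integral_has_real_derivative cont) auto
    then show ?thesis
      using \<open>-1 < t\<close> by (subst (asm) at_within_Icc_at) auto
  qed
  have above: "\<phi> t = 0" if "t > b0" for t
  proof -
    \<comment> \<open>Right of \<open>b0\<close> the primitive is constant, and its value at 1 is
      the vanishing total integral.\<close>
    have "\<exists>c. \<forall>t\<in>{b0..}. \<phi> t = c"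
    proof (rule has_field_derivative_zero_constant)
      fix t assume "t \<in> {b0..}"
      then show "(\<phi> has_real_derivative 0) (at t within {b0..})"
        using has_field_derivative_at_within[OF der, of t] by (simp add: g0)
    qed simp
    moreover have "\<phi> 1 = 0" "b0 \<le> 1"
      using zero ab by (auto simp: \<phi>_def b0_def)
    ultimately show ?thesis
      using that by force
  qed
  show "test_function \<Omega> \<phi>"
  proof (rule test_function_antiderivative[where \<psi> = g and a = a0 and b = b0])
    show "{a0..b0} \<subseteq> \<Omega>"
      using ab by (auto simp: a0_def b0_def)
  qed (use flat_algebra_smooth[OF g] der below above in \<open>auto simp: not_le\<close>)
  show "deriv \<phi> = g"
    using der by (auto intro: DERIV_imp_deriv)
qed

text \<open>Subtracting the right multiple of a fixed bump \<psi> turns any bump into the derivative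
  of a test function, which f annihilates. Hence f integrates against every bump as the constant K
  does, where K is the \<psi>-weighted mean of f, and the fundamental lemma applies to f -
  K.\<close>

lemma du_Bois_Reymond:
  fixes f :: "real \<Rightarrow> complex"
  assumes f: "integrable (lebesgue_on \<Omega>) f"
    and z: "\<And>\<phi>. test_function \<Omega> \<phi> \<Longrightarrow> (LINT t|lebesgue_on \<Omega>. f t * of_real (deriv \<phi> t)) = 0"
  shows "\<exists>K. AE t in lebesgue_on \<Omega>. f t = K"
proof -
  let ?\<psi> = "bump 1 (-1/2) (1/2)"
  have \<psi>: "test_function UNIV ?\<psi>"
    by (rule test_function_bump) auto
  define c where "c = integral {-1..1} ?\<psi>"
  have cont: "continuous_on A (bump m a b)" if "m > 0" for A m a b
    using flat_algebra_smooth[OF flat_algebra_bump, of 0] field_differentiable_imp_continuous_at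
      continuous_at_imp_continuous_on by (metis funpow_0)
  have "c \<noteq> 0"
  proof
    assume "c = 0"
    then have "\<forall>t\<in>{-1..1}. ?\<psi> t = 0"
      unfolding c_def by (subst (asm) integral_eq_0_iff) (auto simp: bump_nonneg intro: cont)
    then show False
      using bump_pos[of 1 0 "-1/2" "1/2"] by simp
  qed
  define K where "K = (LINT t|lebesgue_on \<Omega>. f t * of_real (?\<psi> t)) / of_real c"
  interpret finite_measure "lebesgue_on \<Omega>"
    by (rule finite_measure_lebesgue_on) simp
  have "AE t in lebesgue_on \<Omega>. f t - K = 0"
  proof (rule AE_zero_if_test_integrals_zero)
    fix a b m :: real
    assume ab: "-1 < a" "a < b" "b < 1" "0 < m"
    let ?p = "bump m a b"
    define r where "r = integral {-1..1} ?p / c"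
    have "integral {-1..1} (\<lambda>t. ?p t - r * ?\<psi> t) = integral {-1..1} ?p - r * c"
      unfolding c_def
      by (subst integral_diff) (auto intro!: integrable_continuous_real continuous_intros cont ab)
    also have "\<dots> = 0"
      using \<open>c \<noteq> 0\<close> by (simp add: r_def)
    finally obtain \<phi> where \<phi>: "test_function \<Omega> \<phi>" "deriv \<phi> = (\<lambda>t. ?p t - r * ?\<psi> t)"
      using bump_difference_antiderivative[OF ab] by blast
    have ip: "integrable (lebesgue_on \<Omega>) (\<lambda>t. h t * of_real (bump m a b t))"
      if "integrable (lebesgue_on \<Omega>) h" "m > 0" for h :: "real \<Rightarrow> complex" and m a b
      using that by (intro integrable_mult_continuous_\<Omega> continuous_of_real_test_function[of UNIV] test_function_bump) auto
    have "0 = (LINT t|lebesgue_on \<Omega>. f t * of_real (?p t) - of_real r * (f t * of_real (?\<psi> t)))"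
      using z[OF \<phi>(1)] by (simp add: \<phi>(2) algebra_simps)
    also have "\<dots> = (LINT t|lebesgue_on \<Omega>. f t * of_real (?p t)) - of_real r * (LINT t|lebesgue_on \<Omega>. f t * of_real (?\<psi> t))"
      using ip[OF f] ab by (subst Bochner_Integration.integral_diff) auto
    also have "of_real r * (LINT t|lebesgue_on \<Omega>. f t * of_real (?\<psi> t)) = K * of_real (integral {-1..1} ?p)"
      using \<open>c \<noteq> 0\<close> by (simp add: K_def r_def)
    also have "of_real (integral {-1..1} ?p) = (LINT t|lebesgue_on \<Omega>. complex_of_real (?p t))"
      using ip[of "\<lambda>_. 1" m a b] ab
        integral_linear[OF integrable_continuous_real[OF cont] bounded_linear_of_real[where 'a = complex], of m "-1" 1 a b]
      by (subst integral_lebesgue_on_\<Omega>) (auto simp: o_def)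
    finally have "(LINT t|lebesgue_on \<Omega>. f t * of_real (?p t)) - (LINT t|lebesgue_on \<Omega>. K * of_real (?p t)) = 0"
      by simp
    then show "(LINT t|lebesgue_on \<Omega>. (f t - K) * of_real (?p t)) = 0"
      using ip[OF f, of m a b] ip[of "\<lambda>_. K" m a b] ab
      by (simp add: left_diff_distrib Bochner_Integration.integral_diff)
  qed (use f in auto)
  then show ?thesis by (intro exI[of _ K]) simp
qed

section \<open>Continuous representatives of Sobolev functions\<close>

lemma AE_\<Omega>_negligible:
  assumes "AE t in lebesgue_on \<Omega>. P t"
  shows "negligible {t \<in> \<Omega>. \<not> P t}"
proof -
  have "AE t in lebesgue. t \<in> \<Omega> \<longrightarrow> P t"
    using assms by (simp add: AE_restrict_space_iff)
  then show ?thesis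
    by (subst (asm) eventually_ae_filter)
      (auto simp: negligible_iff_null_sets elim!: completion.complete2[rotated])
qed

lemma integral_cong_AE_\<Omega>:
  fixes f g :: "real \<Rightarrow> complex"
  assumes "AE t in lebesgue_on \<Omega>. f t = g t" "-1 \<le> a" "b \<le> 1"
  shows "integral {a..b} f = integral {a..b} g"
proof (rule integral_spike)
  show "negligible ({t \<in> \<Omega>. f t \<noteq> g t} \<union> {-1, 1})"
    using AE_\<Omega>_negligible[OF assms(1)] by (intro negligible_Un) auto
qed (use assms(2,3) in force)

lemma weak_deriv_H1_on:
  assumes "u \<in> H1_on \<Omega>"
  shows "weak_deriv \<Omega> u \<in> L2_on \<Omega>" "is_weak_deriv \<Omega> u (weak_deriv \<Omega> u)"
proof -
  have "\<exists>u'. u' \<in> L2_on \<Omega> \<and> is_weak_deriv \<Omega> u u'"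
    using assms by (auto simp: H1_on_def)
  then have "weak_deriv \<Omega> u \<in> L2_on \<Omega> \<and> is_weak_deriv \<Omega> u (weak_deriv \<Omega> u)"
    unfolding weak_deriv_def by (rule someI_ex)
  then show "weak_deriv \<Omega> u \<in> L2_on \<Omega>" "is_weak_deriv \<Omega> u (weak_deriv \<Omega> u)"
    by auto
qed

lemma boundary_trace_\<Omega>_eqI:
  assumes "continuous_on {-1..1} w" "AE t in lebesgue_on \<Omega>. u t = w t" "p \<in> {-1..1}"
  shows "boundary_trace \<Omega> u p = w p"
  by (rule boundary_trace_eqI) (use assms in \<open>auto simp: closure_greaterThanLessThan elim!: eventually_mono\<close>)

text \<open>The difference of u and the primitive of its weak derivative has zero weak derivative,
  hence is constant. The resulting version is continuous up to the boundary, which is what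
  \<open>boundary_trace\<close> reads off.\<close>

lemma H1_on_representative:
  assumes u: "u \<in> H1_on \<Omega>"
  obtains K where "AE t in lebesgue_on \<Omega>. u t = K + integral {-1..t} (weak_deriv \<Omega> u)"
proof -
  let ?w = "weak_deriv \<Omega> u"
  have w: "integrable (lebesgue_on \<Omega>) ?w"
    by (intro integrable_L2_on weak_deriv_H1_on u)
  have iu: "integrable (lebesgue_on \<Omega>) u"
    using u by (intro integrable_L2_on) (simp add: H1_on_def)
  have iW: "integrable (lebesgue_on \<Omega>) (\<lambda>t. integral {-1..t} ?w)"
    by (intro integrable_continuous_\<Omega> continuous_primitive w)
  have "\<exists>K. AE t in lebesgue_on \<Omega>. u t - integral {-1..t} ?w = K"
  proof (rule du_Bois_Reymond)
    fix \<phi> assume \<phi>: "test_function \<Omega> \<phi>"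
    note int = integrable_mult_continuous_\<Omega>[OF _ continuous_of_real_deriv_test_function[OF \<phi>]]
    have "(LINT t|lebesgue_on \<Omega>. integral {-1..t} ?w * of_real (deriv \<phi> t))
        = - (LINT t|lebesgue_on \<Omega>. ?w t * of_real (\<phi> t))"
      using is_weak_deriv_primitive[OF w, of 0] \<phi> by (simp add: is_weak_deriv_def)
    moreover have "(LINT t|lebesgue_on \<Omega>. u t * of_real (deriv \<phi> t))
        = - (LINT t|lebesgue_on \<Omega>. ?w t * of_real (\<phi> t))"
      using weak_deriv_H1_on(2)[OF u] \<phi> by (simp add: is_weak_deriv_def)
    ultimately show "(LINT t|lebesgue_on \<Omega>. (u t - integral {-1..t} ?w) * of_real (deriv \<phi> t)) = 0"
      using int[OF iu] int[OF iW] by (simp add: left_diff_distrib Bochner_Integration.integral_diff)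
  qed (use iu iW in auto)
  then obtain K where "AE t in lebesgue_on \<Omega>. u t - integral {-1..t} ?w = K"
    by blast
  then have "AE t in lebesgue_on \<Omega>. u t = K + integral {-1..t} ?w"
    by eventually_elim (auto simp: algebra_simps)
  then show thesis by (rule that)
qed

text \<open>The source of test elements for the weak form: a derivative may be prescribed freely in
  L2, even a discontinuous one.\<close>

lemma H1_on_primitive:
  assumes "w \<in> L2_on \<Omega>"
  shows "(\<lambda>t. K + integral {-1..t} w) \<in> H1_on \<Omega>"
    and "AE t in lebesgue_on \<Omega>. weak_deriv \<Omega> (\<lambda>t. K + integral {-1..t} w) t = w t"
proof -
  have w: "integrable (lebesgue_on \<Omega>) w"
    using assms by (rule integrable_L2_on)
  then have wd: "is_weak_deriv \<Omega> (\<lambda>t. K + integral {-1..t} w) w"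
    by (rule is_weak_deriv_primitive)
  have "(\<lambda>t. K + integral {-1..t} w) \<in> L2_on \<Omega>"
    by (intro continuous_L2_on continuous_intros continuous_primitive w)
  with wd assms show H1: "(\<lambda>t. K + integral {-1..t} w) \<in> H1_on \<Omega>"
    by (auto simp: H1_on_def)
  show "AE t in lebesgue_on \<Omega>. weak_deriv \<Omega> (\<lambda>t. K + integral {-1..t} w) t = w t"
    by (rule weak_deriv_AE_unique[OF integrable_L2_on w weak_deriv_H1_on(2) wd])
      (intro weak_deriv_H1_on H1)+
qed

text \<open>Testing with the primitives of indicator functions of intervals yields the differential
  equation and the impedance condition at the left end point at once.\<close>

lemma helmholtz_solution_weak_deriv:
  assumes sol: "helmholtz_solution \<omega> c g1 g2 u"
    and f: "integrable (lebesgue_on \<Omega>) (\<lambda>t. of_real ((\<omega> / c t)\<^sup>2) * u t)"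
  shows "AE t in lebesgue_on \<Omega>. weak_deriv \<Omega> u t =
     - g1 - \<i> * of_real (\<omega> / c (-1)) * boundary_trace \<Omega> u (-1)
     - integral {-1..t} (\<lambda>t. of_real ((\<omega> / c t)\<^sup>2) * u t)"
proof -
  let ?w = "weak_deriv \<Omega> u"
  let ?f = "\<lambda>t. of_real ((\<omega> / c t)\<^sup>2) * u t"
  let ?F = "\<lambda>t. integral {-1..t} ?f"
  define d where "d = g1 + \<i> * of_real (\<omega> / c (-1)) * boundary_trace \<Omega> u (-1)"
  have u: "u \<in> H1_on \<Omega>"
    using sol by (simp add: helmholtz_solution_def)
  have w: "integrable (lebesgue_on \<Omega>) ?w"
    by (intro integrable_L2_on weak_deriv_H1_on u)
  have F: "continuous_on {-1..1} ?F"
    by (rule continuous_primitive[OF f])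
  have const: "integrable (lebesgue_on \<Omega>) (\<lambda>t. k)" for k :: complex
    by (intro integrable_continuous_\<Omega> continuous_intros)
  have "AE t in lebesgue_on \<Omega>. ?w t + (?F t + d) = 0"
  proof (rule AE_zero_if_interval_integrals_zero)
    show "integrable (lebesgue_on \<Omega>) (\<lambda>t. ?w t + (?F t + d))"
      by (intro Bochner_Integration.integrable_add w const integrable_continuous_\<Omega>[OF F])
    fix a b :: real
    assume ab: "-1 < a" "a < b" "b < 1"
    let ?\<eta> = "\<lambda>t. indicator {a<..<b} t :: complex"
    \<comment> \<open>\<open>v\<close> equals b - a up to a, falls with slope -1 on the interval,
      and is 0 from b on. Its zero trace at 1 removes g2, and its trace b - a at -1 brings in
      exactly the left impedance condition.\<close>
    define v where "v = (\<lambda>t. of_real (b - a) + integral {-1..t} (\<lambda>t. - ?\<eta> t))"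
    have \<eta>m: "?\<eta> \<in> borel_measurable (lebesgue_on \<Omega>)"
      using integrable_indicator_mult[OF const[of 1], of "{a<..<b}"] by auto
    have \<eta>: "(\<lambda>t. - ?\<eta> t) \<in> L2_on \<Omega>"
      using \<eta>m by (intro L2_onI_bounded[of _ 1]) (auto simp: indicator_def)
    have i\<eta>: "integrable (lebesgue_on \<Omega>) ?\<eta>"
      using integrable_L2_on[OF \<eta>] by simp
    have v_eq: "v t = integral {t..1} ?\<eta>" if "t \<in> {-1..1}" for t
    proof -
      have "integral {-1..1} ?\<eta> = of_real (b - a)"
        using integral_indicator_\<Omega>[OF const[of 1], of a b] ab integral_lebesgue_on_\<Omega>[OF i\<eta>]
        by (simp add: scaleR_conv_of_real)
      then show ?thesis
        using Henstock_Kurzweil_Integration.integral_combine[of "-1" t 1 ?\<eta>] that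
          integrable_on_of_\<Omega>[OF i\<eta>, of "-1" 1]
        by (auto simp: v_def algebra_simps)
    qed
    have vH: "v \<in> H1_on \<Omega>" "AE t in lebesgue_on \<Omega>. weak_deriv \<Omega> v t = - ?\<eta> t"
      unfolding v_def by (rule H1_on_primitive[OF \<eta>])+
    have cv: "continuous_on {-1..1} v"
      unfolding v_def by (intro continuous_intros continuous_primitive integrable_L2_on \<eta>)
    have tr: "boundary_trace \<Omega> v (-1) = of_real (b - a)" "boundary_trace \<Omega> v 1 = 0"
      using boundary_trace_\<Omega>_eqI[OF cv, of v "-1"] boundary_trace_\<Omega>_eqI[OF cv, of v 1] v_eq[of 1] v_eq[of "-1"]
      by (auto simp: v_def)
    have "cnj (- ?\<eta> t) = - ?\<eta> t" for t
      by (simp add: indicator_def)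
    \<comment> \<open>\<open>v\<close> is real-valued, so the conjugations in the weak form
      disappear.\<close>
    then have real: "cnj (v t) = v t" for t
      unfolding v_def by (simp only: complex_cnj_add complex_cnj_complex_of_real Henstock_Kurzweil_Integration.integral_cnj)
    have i1: "integrable (lebesgue_on \<Omega>) (\<lambda>t. ?\<eta> t * ?w t)"
      by (intro integrable_indicator_mult w) auto
    have i2: "integrable (lebesgue_on \<Omega>) (\<lambda>t. ?f t * v t)"
      by (rule integrable_mult_continuous_\<Omega>[OF f cv])
    have wm: "?w \<in> borel_measurable (lebesgue_on \<Omega>)" "weak_deriv \<Omega> v \<in> borel_measurable (lebesgue_on \<Omega>)"
      using weak_deriv_H1_on(1)[OF u] weak_deriv_H1_on(1)[OF vH(1)] by (auto simp: L2_on_def)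
    have cnjm: "cnj \<in> borel_measurable borel"
      by (intro borel_measurable_continuous_onI continuous_intros)
    have "(LINT t|lebesgue_on \<Omega>. ?w t * cnj (weak_deriv \<Omega> v t) - ?f t * cnj (v t))
        = (LINT t|lebesgue_on \<Omega>. - (?\<eta> t * ?w t) - ?f t * v t)"
    proof (rule integral_cong_AE)
      show "AE t in lebesgue_on \<Omega>. ?w t * cnj (weak_deriv \<Omega> v t) - ?f t * cnj (v t)
          = - (?\<eta> t * ?w t) - ?f t * v t"
        using vH(2) by eventually_elim (simp only: real, simp add: indicator_def)
      show "(\<lambda>t. ?w t * cnj (weak_deriv \<Omega> v t) - ?f t * cnj (v t)) \<in> borel_measurable (lebesgue_on \<Omega>)"
        unfolding real
        by (intro borel_measurable_diff borel_measurable_times[OF wm(1) measurable_compose[OF wm(2) cnjm]]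
            borel_measurable_integrable[OF i2])
      show "(\<lambda>t. - (?\<eta> t * ?w t) - ?f t * v t) \<in> borel_measurable (lebesgue_on \<Omega>)"
        using borel_measurable_integrable[OF i1] borel_measurable_integrable[OF i2] by auto
    qed
    also have "\<dots> = - (LINT t|lebesgue_on \<Omega>. ?\<eta> t * ?w t) - (LINT t|lebesgue_on \<Omega>. ?f t * v t)"
      using i1 i2 by (subst Bochner_Integration.integral_diff) auto
    also have "(LINT t|lebesgue_on \<Omega>. ?\<eta> t * ?w t) = integral {a..b} ?w"
      using ab by (intro integral_indicator_\<Omega> w) auto
    \<comment> \<open>Writing \<open>v\<close> as an integral from t to 1 lets the swap move the
      integration onto \<open>?f\<close>, so that the zeroth-order term becomes an integral of
      \<open>?F\<close> over the same interval as that of \<open>?w\<close>.\<close>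
    also have "(LINT t|lebesgue_on \<Omega>. ?f t * v t) = (LINT t|lebesgue_on \<Omega>. ?f t * integral {t..1} ?\<eta>)"
      by (rule Bochner_Integration.integral_cong[OF refl]) (simp add: v_eq)
    also have "\<dots> = (LINT t|lebesgue_on \<Omega>. ?\<eta> t * ?F t)"
      by (rule integral_swap_primitives[OF f i\<eta>])
    also have "\<dots> = integral {a..b} ?F"
      using ab by (intro integral_indicator_\<Omega> integrable_continuous_\<Omega> F) auto
    finally have lhs: "(LINT t|lebesgue_on \<Omega>. ?w t * cnj (weak_deriv \<Omega> v t) - ?f t * cnj (v t))
        = - integral {a..b} ?w - integral {a..b} ?F" .
    have "(LINT t|lebesgue_on \<Omega>. ?w t * cnj (weak_deriv \<Omega> v t) - ?f t * cnj (v t))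
        - \<i> * (\<Sum>p\<in>{-1, 1}. of_real (\<omega> / c p) * boundary_trace \<Omega> u p * cnj (boundary_trace \<Omega> v p))
        = g1 * cnj (boundary_trace \<Omega> v (-1)) + g2 * cnj (boundary_trace \<Omega> v 1)"
      using sol vH(1) unfolding helmholtz_solution_def by blast
    then have "- integral {a..b} ?w - integral {a..b} ?F
        - \<i> * (of_real (\<omega> / c (-1)) * boundary_trace \<Omega> u (-1) * of_real (b - a)) = g1 * of_real (b - a)"
      unfolding lhs by (simp add: tr)
    moreover have "integral {a..b} (\<lambda>t. ?w t + (?F t + d)) = integral {a..b} ?w + (integral {a..b} ?F + of_real (b - a) * d)"
    proof -
      have "?w integrable_on {a..b}" "?F integrable_on {a..b}" "(\<lambda>t. d) integrable_on {a..b}"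
        using ab by (intro integrable_on_of_\<Omega> w integrable_continuous_\<Omega>[OF F] const; simp)+
      then show ?thesis
        using ab by (simp add: Henstock_Kurzweil_Integration.integral_add integrable_add scaleR_conv_of_real)
    qed
    ultimately show "integral {a..b} (\<lambda>t. ?w t + (?F t + d)) = 0"
      unfolding d_def by (simp add: algebra_simps)
  qed
  then show ?thesis
  proof eventually_elim
    case (elim t)
    then have "?w t = - (?F t + d)"
      by (simp only: eq_neg_iff_add_eq_0)
    then show ?case
      by (simp add: d_def)
  qed
qed


section \<open>Piecewise constant speeds\<close>

text \<open>In the real inner product of the complex plane the derivative of the energy is 2 <V,
  -\<kappa>^2 U> + 2 \<kappa>^2 <U, V> = 0. Derivatives within the closed interval suffice, which is
  all that a single piece offers at its ends.\<close>

lemma oscillator_energy_constant: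
  fixes U V :: "real \<Rightarrow> complex"
  assumes U: "\<And>t. t \<in> {a..b} \<Longrightarrow> (U has_vector_derivative V t) (at t within {a..b})"
    and V: "\<And>t. t \<in> {a..b} \<Longrightarrow> (V has_vector_derivative - (\<kappa>\<^sup>2 *\<^sub>R U t)) (at t within {a..b})"
    and t: "t \<in> {a..b}"
  shows "(norm (V t))\<^sup>2 + \<kappa>\<^sup>2 * (norm (U t))\<^sup>2 = (norm (V a))\<^sup>2 + \<kappa>\<^sup>2 * (norm (U a))\<^sup>2"
proof -
  let ?E = "\<lambda>t. V t \<bullet> V t + \<kappa>\<^sup>2 * (U t \<bullet> U t)"
  have "\<exists>e. \<forall>t\<in>{a..b}. ?E t = e"
  proof (rule has_derivative_zero_constant)
    fix t assume t: "t \<in> {a..b}"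
    show "(?E has_derivative (\<lambda>h. 0)) (at t within {a..b})"
      using U[OF t] V[OF t] unfolding has_vector_derivative_def
      by (auto intro!: derivative_eq_intros ext simp: inner_commute algebra_simps)
  qed simp
  then have "?E t = ?E a"
    using t by force
  then show ?thesis
    by (simp add: dot_square_norm)
qed

context
  fixes cmin cmax :: real and n :: nat and x cs :: "nat \<Rightarrow> real" and c :: "real \<Rightarrow> real"
  assumes speed: "piecewise_constant_speed cmin cmax n x cs c" and cmin: "0 < cmin"
begin

lemma speed_facts:
  assumes "j \<in> {1..n+1}"
  shows "x (j - 1) < x j" "cmin \<le> cs j" "cs j \<le> cmax" "t \<in> {x (j - 1)<..<x j} \<Longrightarrow> c t = cs j"
  using speed assms by (auto simp: piecewise_constant_speed_def)

lemma speed_ends: "x 0 = -1" "x (n + 1) = 1" "c (-1) = cs 1" "c 1 = cs (n + 1)"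
  using speed by (auto simp: piecewise_constant_speed_def)

lemma speed_points_mono: "i \<le> j \<Longrightarrow> j \<le> n + 1 \<Longrightarrow> x i \<le> x j"
proof (induction j rule: dec_induct)
  case (step j)
  then show ?case using speed_facts(1)[of "Suc j"] by simp
qed simp

lemma speed_piece_subset:
  assumes "j \<in> {1..n+1}"
  shows "{x (j - 1)..x j} \<subseteq> {-1..1}"
  using speed_points_mono[of 0 "j - 1"] speed_points_mono[of j "n + 1"] speed_ends assms by auto

lemma speed_piece_exists:
  assumes "t \<in> {-1..1}"
  shows "\<exists>j\<in>{1..n+1}. t \<in> {x (j - 1)..x j}"
\<comment> \<open>For t = -1 the least index with t \<le> x j would be 0, which numbers no
  piece.\<close>
proof (cases "t = -1")
  case True
  then show ?thesis
    using speed_facts(1)[of 1] speed_ends by (intro bexI[of _ 1]) auto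
next
  case False
  define j where "j = (LEAST j. t \<le> x j)"
  have "t \<le> x (n + 1)"
    using assms speed_ends by simp
  then have j: "t \<le> x j" "j \<le> n + 1"
    unfolding j_def by (rule LeastI, rule Least_le)
  have "j \<noteq> 0"
    using j(1) False assms speed_ends(1) by (cases "j = 0") auto
  moreover from this have "\<not> t \<le> x (j - 1)"
    unfolding j_def by (intro not_less_Least) simp
  ultimately show ?thesis
    using j by (intro bexI[of _ j]) auto
qed

lemma speed_open_piece_exists:
  assumes "t \<in> \<Omega>" "t \<notin> x ` {..n+1}"
  shows "\<exists>j\<in>{1..n+1}. t \<in> {x (j - 1)<..<x j}"
proof -
  obtain j where j: "j \<in> {1..n+1}" "t \<in> {x (j - 1)..x j}"
    using speed_piece_exists[of t] assms by auto
  moreover have "t \<noteq> x (j - 1)" "t \<noteq> x j"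
    using assms(2) j(1) by auto
  ultimately show ?thesis
    by (intro bexI[of _ j]) auto
qed

text \<open>\<open>c\<close> is arbitrary at the interior jump points, so statements about c(t) hold
  only off this finite, hence null, set.\<close>

lemma AE_speed_piece:
  "AE t in lebesgue_on \<Omega>. \<exists>j\<in>{1..n+1}. t \<in> {x (j - 1)<..<x j}"
proof -
  have "AE t in lebesgue. t \<notin> x ` {..n+1}"
    by (intro AE_not_in) (simp add: negligible_iff_null_sets[symmetric] negligible_finite)
  then have "AE t in lebesgue. t \<in> \<Omega> \<longrightarrow> (\<exists>j\<in>{1..n+1}. t \<in> {x (j - 1)<..<x j})"
    by eventually_elim (use speed_open_piece_exists in blast)
  then show ?thesis
    by (simp add: AE_restrict_space_iff)
qed

text \<open>On the union of the open pieces \<open>c\<close> is locally constant, thus continuous;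
  what is left of \<Omega> is finite, and arbitrary values there do not affect
  measurability.\<close>

lemma speed_measurable: "c \<in> borel_measurable (lebesgue_on \<Omega>)"
proof -
  define D where "D = (\<Union>j\<in>{1..n+1}. {x (j - 1)<..<x j})"
  have "continuous_on {x (j - 1)<..<x j} c" if "j \<in> {1..n+1}" for j
    by (rule continuous_on_eq[OF continuous_on_const[of _ "cs j"]])
      (use speed_facts(4)[OF that] in simp)
  then have "continuous_on D c"
    unfolding D_def by (intro continuous_on_open_UN) auto
  moreover have "D \<in> sets borel"
    by (auto simp: D_def)
  ultimately have "(\<lambda>t. indicator D t *\<^sub>R c t) \<in> borel_measurable borel"
    by (intro borel_measurable_continuous_on_indicator)
  then have "(\<lambda>t. indicator D t *\<^sub>R c t) \<in> borel_measurable lebesgue"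
    by (intro measurable_completion) simp
  then have "(\<lambda>t. indicator D t *\<^sub>R c t) \<in> borel_measurable (lebesgue_on \<Omega>)"
    by (rule measurable_restrict_space1)
  then show ?thesis
  proof (rule measurable_discrete_difference[where X = "x ` {..n+1} \<inter> \<Omega>"])
    show "{t} \<in> sets (lebesgue_on \<Omega>)" if "t \<in> x ` {..n+1} \<inter> \<Omega>" for t
      using that by (subst sets_restrict_space_iff) auto
    show "indicator D t *\<^sub>R c t = c t"
      if "t \<in> space (lebesgue_on \<Omega>)" "t \<notin> x ` {..n+1} \<inter> \<Omega>" for t
    proof -
      have "t \<in> D"
        using speed_open_piece_exists[of t] that unfolding D_def by auto
      then show ?thesis by simp
    qed
  qed (auto intro: countable_finite)
qed

lemma speed_factor_integrable:
  fixes u :: "real \<Rightarrow> complex"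
  assumes "integrable (lebesgue_on \<Omega>) u"
  shows "integrable (lebesgue_on \<Omega>) (\<lambda>t. of_real ((\<omega> / c t)\<^sup>2) * u t)"
proof -
  have "integrable (lebesgue_on \<Omega>) (\<lambda>t. u t * of_real ((\<omega> / c t)\<^sup>2))"
  proof (rule integrable_mult_bounded_\<Omega>[OF assms])
    show "(\<lambda>t. complex_of_real ((\<omega> / c t)\<^sup>2)) \<in> borel_measurable (lebesgue_on \<Omega>)"
      using speed_measurable by measurable
    show "AE t in lebesgue_on \<Omega>. norm (complex_of_real ((\<omega> / c t)\<^sup>2)) \<le> (\<omega> / cmin)\<^sup>2"
      using AE_speed_piece
    proof eventually_elim
      case (elim t)
      then obtain j where j: "j \<in> {1..n+1}" "c t = cs j"
        using speed_facts(4) by blast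
      then have "\<omega>\<^sup>2 / (cs j)\<^sup>2 \<le> \<omega>\<^sup>2 / cmin\<^sup>2"
        using speed_facts(2)[OF j(1)] cmin by (intro divide_left_mono power_mono mult_pos_pos) auto
      then show ?case
        using j by (simp add: norm_power norm_divide power_divide)
    qed
  qed
  then show ?thesis
    by (simp add: mult.commute)
qed

text \<open>The weight is \<open>cs j\<close> rather than \<open>c t\<close>, so the estimate
  extends to closed pieces: at a jump point the energies of both neighbours make sense and can be
  compared. The exponent j - 1 counts the jumps to the left of piece j.\<close>

lemma piecewise_energy_bound:
  fixes U V :: "real \<Rightarrow> complex" and \<omega> :: real
  assumes U: "\<And>t. t \<in> {-1..1} \<Longrightarrow> (U has_vector_derivative V t) (at t within {-1..1})"
    and V: "\<And>t. t \<in> {-1..1} \<Longrightarrow> V t = V (-1) - integral {-1..t} (\<lambda>s. of_real ((\<omega> / c s)\<^sup>2) * U s)"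
    and j: "j \<in> {1..n+1}" and t: "t \<in> {x (j - 1)..x j}"
  shows "(norm (V t))\<^sup>2 + (\<omega> / cs j)\<^sup>2 * (norm (U t))\<^sup>2
     \<le> ((cmax / cmin)\<^sup>2) ^ (j - 1) * ((norm (V (-1)))\<^sup>2 + (\<omega> / cs 1)\<^sup>2 * (norm (U (-1)))\<^sup>2)"
proof -
  let ?f = "\<lambda>s. of_real ((\<omega> / c s)\<^sup>2) * U s"
  have contU: "continuous_on {-1..1} U"
    using U has_vector_derivative_continuous continuous_on_eq_continuous_within by blast
  have f: "integrable (lebesgue_on \<Omega>) ?f"
    by (intro speed_factor_integrable integrable_continuous_\<Omega> contU)
  have const: "(norm (V t))\<^sup>2 + (\<omega> / cs j)\<^sup>2 * (norm (U t))\<^sup>2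
      = (norm (V (x (j - 1))))\<^sup>2 + (\<omega> / cs j)\<^sup>2 * (norm (U (x (j - 1))))\<^sup>2"
    if j: "j \<in> {1..n+1}" and t: "t \<in> {x (j - 1)..x j}" for j t
  proof (rule oscillator_energy_constant[OF _ _ t])
    let ?a = "x (j - 1)" and ?b = "x j"
    note sub = speed_piece_subset[OF j]
    have ab: "?a < ?b" by (rule speed_facts(1)[OF j])
    then have a: "-1 \<le> ?a" "?b \<le> 1" using sub by auto
    \<comment> \<open>Restarting the integral at the left end of the piece makes the coefficient
      constant and the integrand continuous, so V is differentiable up to both ends of the
      piece.\<close>
    have V_eq: "V ?a - integral {?a..s} (\<lambda>r. (\<omega> / cs j)\<^sup>2 *\<^sub>R U r) = V s" if s: "s \<in> {?a..?b}" for s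
    proof -
      have 1: "integral {?a..s} (\<lambda>r. (\<omega> / cs j)\<^sup>2 *\<^sub>R U r) = integral {?a..s} ?f"
      proof (rule integral_spike[of "{?a, ?b}"])
        fix r assume "r \<in> {?a..s} - {?a, ?b}"
        then have "r \<in> {?a<..<?b}" using s by auto
        then show "?f r = (\<omega> / cs j)\<^sup>2 *\<^sub>R U r"
          using speed_facts(4)[OF j] by (simp add: scaleR_conv_of_real)
      qed simp
      have 2: "integral {-1..?a} ?f + integral {?a..s} ?f = integral {-1..s} ?f"
        using s a by (intro Henstock_Kurzweil_Integration.integral_combine integrable_on_of_\<Omega>[OF f]) auto
      have 3: "V ?a = V (-1) - integral {-1..?a} ?f" "V s = V (-1) - integral {-1..s} ?f"
        by (rule V, use s a ab in simp)+
      show ?thesis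
        unfolding 1 3 2[symmetric] by (rule diff_diff_eq)
    qed
    fix s assume s: "s \<in> {?a..?b}"
    show "(U has_vector_derivative V s) (at s within {?a..?b})"
      using U[of s] s sub by (blast intro: has_vector_derivative_within_subset)
    have "continuous_on {?a..?b} (\<lambda>r. (\<omega> / cs j)\<^sup>2 *\<^sub>R U r)"
      by (intro continuous_intros continuous_on_subset[OF contU sub])
    from integral_has_vector_derivative[OF this s]
    have "((\<lambda>s. V ?a - integral {?a..s} (\<lambda>r. (\<omega> / cs j)\<^sup>2 *\<^sub>R U r)) has_vector_derivative
        0 - (\<omega> / cs j)\<^sup>2 *\<^sub>R U s) (at s within {?a..?b})"
      by (intro has_vector_derivative_diff has_vector_derivative_const)
    then have "((\<lambda>s. V ?a - integral {?a..s} (\<lambda>r. (\<omega> / cs j)\<^sup>2 *\<^sub>R U r)) has_vector_derivative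
        - ((\<omega> / cs j)\<^sup>2 *\<^sub>R U s)) (at s within {?a..?b})"
      by simp
    then show "(V has_vector_derivative - ((\<omega> / cs j)\<^sup>2 *\<^sub>R U s)) (at s within {?a..?b})"
      by (rule has_vector_derivative_transform[OF s, rotated]) (rule V_eq[symmetric])
  qed
  let ?X = "(cmax / cmin)\<^sup>2"
  let ?E0 = "(norm (V (-1)))\<^sup>2 + (\<omega> / cs 1)\<^sup>2 * (norm (U (-1)))\<^sup>2"
  have bound: "\<forall>t\<in>{x i..x (Suc i)}. (norm (V t))\<^sup>2 + (\<omega> / cs (Suc i))\<^sup>2 * (norm (U t))\<^sup>2 \<le> ?X ^ i * ?E0"
    if "i \<le> n" for i
    using that
  proof (induction i)
    case 0
    show ?case
    proof
      fix t assume "t \<in> {x 0..x (Suc 0)}"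
      then show "(norm (V t))\<^sup>2 + (\<omega> / cs (Suc 0))\<^sup>2 * (norm (U t))\<^sup>2 \<le> ?X ^ 0 * ?E0"
        using const[of 1 t] speed_ends(1) by simp
    qed
  next
    case (Suc i)
    let ?y = "x (Suc i)"
    have cs: "cmin \<le> cs (Suc i)" "cs (Suc i) \<le> cmax" "cmin \<le> cs (Suc (Suc i))"
      and y: "x i \<le> ?y"
      using speed_facts(1-3)[of "Suc i"] speed_facts(2)[of "Suc (Suc i)"] Suc.prems by auto
    \<comment> \<open>Across a jump U and V keep their values; only the weight of U changes, and by
      at most the square of cmax/cmin. The term with V is enlarged by the same factor so that the
      old energy can be factored out.\<close>
    have "\<bar>\<omega>\<bar> / cs (Suc (Suc i)) \<le> \<bar>\<omega>\<bar> / cmin"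
      using cs cmin by (intro divide_left_mono mult_pos_pos) auto
    also have "\<dots> = cmax / cmin * (\<bar>\<omega>\<bar> / cmax)"
      using cs cmin by simp
    also have "\<dots> \<le> cmax / cmin * (\<bar>\<omega>\<bar> / cs (Suc i))"
      using cs cmin by (intro mult_left_mono divide_left_mono mult_pos_pos) auto
    finally have "(\<bar>\<omega>\<bar> / cs (Suc (Suc i)))\<^sup>2 \<le> (cmax / cmin * (\<bar>\<omega>\<bar> / cs (Suc i)))\<^sup>2"
      using cs cmin by (intro power_mono) auto
    then have \<kappa>: "(\<omega> / cs (Suc (Suc i)))\<^sup>2 \<le> ?X * (\<omega> / cs (Suc i))\<^sup>2"
      by (simp add: power_mult_distrib power_divide)
    have X1: "1 \<le> ?X"
      using cs cmin by (intro one_le_power) (simp add: le_divide_eq)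
    have "(norm (V ?y))\<^sup>2 + (\<omega> / cs (Suc (Suc i)))\<^sup>2 * (norm (U ?y))\<^sup>2
        \<le> ?X * (norm (V ?y))\<^sup>2 + ?X * (\<omega> / cs (Suc i))\<^sup>2 * (norm (U ?y))\<^sup>2"
      using mult_right_mono[OF X1, of "(norm (V ?y))\<^sup>2"] mult_right_mono[OF \<kappa>, of "(norm (U ?y))\<^sup>2"]
      by simp
    also have "\<dots> = ?X * ((norm (V ?y))\<^sup>2 + (\<omega> / cs (Suc i))\<^sup>2 * (norm (U ?y))\<^sup>2)"
      by (simp only: algebra_simps)
    also have "\<dots> \<le> ?X * (?X ^ i * ?E0)"
      using Suc y by (intro mult_left_mono) auto
    finally have y_le: "(norm (V ?y))\<^sup>2 + (\<omega> / cs (Suc (Suc i)))\<^sup>2 * (norm (U ?y))\<^sup>2 \<le> ?X ^ Suc i * ?E0"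
      by (simp only: power_Suc mult.assoc)
    show ?case
    proof
      fix t assume "t \<in> {?y..x (Suc (Suc i))}"
      with const[of "Suc (Suc i)" t] Suc.prems
      have "(norm (V t))\<^sup>2 + (\<omega> / cs (Suc (Suc i)))\<^sup>2 * (norm (U t))\<^sup>2
          = (norm (V ?y))\<^sup>2 + (\<omega> / cs (Suc (Suc i)))\<^sup>2 * (norm (U ?y))\<^sup>2"
        by simp
      with y_le show "(norm (V t))\<^sup>2 + (\<omega> / cs (Suc (Suc i)))\<^sup>2 * (norm (U t))\<^sup>2 \<le> ?X ^ Suc i * ?E0"
        by (simp only:)
    qed
  qed
  have "j - 1 \<le> n"
    using j by auto
  from bound[OF this] show ?thesis
    using j t by simp
qed

end


section \<open>Stability\<close>

text \<open>For v = u the volume integral is real, so the imaginary part contains boundary terms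
  only. The right-hand side couples both ends; hence the pair (p, q) of end values is bounded as a
  whole by Cauchy-Schwarz, and one factor P cancels.\<close>

lemma helmholtz_boundary_estimate:
  assumes sol: "helmholtz_solution \<omega> c g1 g2 u"
    and m: "0 < m" "m \<le> \<omega> / c (-1)" "m \<le> \<omega> / c 1"
  shows "norm (boundary_trace \<Omega> u (-1)) \<le> sqrt ((norm g1)\<^sup>2 + (norm g2)\<^sup>2) / m"
proof -
  define p q where "p = boundary_trace \<Omega> u (-1)" and "q = boundary_trace \<Omega> u 1"
  define k1 k2 where "k1 = \<omega> / c (-1)" and "k2 = \<omega> / c 1"
  define G where "G = sqrt ((norm g1)\<^sup>2 + (norm g2)\<^sup>2)"
  define P where "P = sqrt ((norm p)\<^sup>2 + (norm q)\<^sup>2)"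
  define R where "R = (LINT t|lebesgue_on \<Omega>. (norm (weak_deriv \<Omega> u t))\<^sup>2 - (\<omega> / c t)\<^sup>2 * (norm (u t))\<^sup>2)"
  have "(LINT t|lebesgue_on \<Omega>. weak_deriv \<Omega> u t * cnj (weak_deriv \<Omega> u t)
      - of_real ((\<omega> / c t)\<^sup>2) * u t * cnj (u t)) = of_real R"
    \<comment> \<open>Passing \<open>of_real\<close> through the integral holds in any case: a
      non-integrable function has integral 0 on both sides.\<close>
    unfolding R_def integral_complex_of_real[symmetric]
    by (simp only: of_real_diff of_real_mult mult.assoc complex_norm_square)
  moreover have "(LINT t|lebesgue_on \<Omega>. weak_deriv \<Omega> u t * cnj (weak_deriv \<Omega> u t)
        - of_real ((\<omega> / c t)\<^sup>2) * u t * cnj (u t))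
      - \<i> * (\<Sum>p\<in>{-1, 1}. of_real (\<omega> / c p) * boundary_trace \<Omega> u p * cnj (boundary_trace \<Omega> u p))
      = g1 * cnj (boundary_trace \<Omega> u (-1)) + g2 * cnj (boundary_trace \<Omega> u 1)"
    using sol unfolding helmholtz_solution_def by blast
  ultimately have "of_real R - \<i> * (of_real k1 * (p * cnj p) + of_real k2 * (q * cnj q)) = g1 * cnj p + g2 * cnj q"
    by (simp add: k1_def k2_def p_def q_def mult.assoc)
  then have "of_real R - \<i> * of_real (k1 * (norm p)\<^sup>2 + k2 * (norm q)\<^sup>2) = g1 * cnj p + g2 * cnj q"
    by (simp only: of_real_add of_real_mult complex_norm_square)
  from arg_cong[OF this, of Im]
  have "- (k1 * (norm p)\<^sup>2 + k2 * (norm q)\<^sup>2) = Im (g1 * cnj p + g2 * cnj q)"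
    by simp
  then have "k1 * (norm p)\<^sup>2 + k2 * (norm q)\<^sup>2 \<le> norm (g1 * cnj p + g2 * cnj q)"
    using abs_Im_le_cmod[of "g1 * cnj p + g2 * cnj q"] by linarith
  also have "\<dots> \<le> norm g1 * norm p + norm g2 * norm q"
    by (rule order_trans[OF norm_triangle_ineq]) (simp add: norm_mult)
  also have "\<dots> \<le> G * P"
    using norm_cauchy_schwarz[of "(norm g1, norm g2)" "(norm p, norm q)"]
    by (simp add: G_def P_def norm_Pair)
  finally have "k1 * (norm p)\<^sup>2 + k2 * (norm q)\<^sup>2 \<le> G * P" .
  moreover have "m * (norm p)\<^sup>2 + m * (norm q)\<^sup>2 \<le> k1 * (norm p)\<^sup>2 + k2 * (norm q)\<^sup>2"
    using m by (intro add_mono mult_right_mono) (auto simp: k1_def k2_def)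
  moreover have "m * (norm p)\<^sup>2 + m * (norm q)\<^sup>2 = m * P * P"
    by (simp add: P_def algebra_simps)
  ultimately have "m * P * P \<le> G * P"
    by linarith
  moreover have "0 \<le> P" "0 \<le> G"
    by (auto simp: P_def G_def)
  ultimately have "P \<le> G / m"
    using m(1) by (cases "P = 0") (auto simp: field_simps)
  moreover have "norm p \<le> P"
    by (simp add: P_def)
  ultimately show ?thesis
    by (simp add: p_def G_def)
qed

text \<open>Origin of the constant: at -1 the terms |V| and (\<omega>/c)|U| are both at most (1 +
  \<rho>) G, so the initial energy is at most 2 ((1 + \<rho>) G)^2. The jumps contribute \<rho>^(2n)
  and the length of \<Omega> another 2; the square root gives 2 (1 + \<rho>) \<rho>^n G.\<close>

lemma helmholtz_stability:
  assumes \<omega>: "\<omega> > 0" and cm: "0 < cmin" "cmin \<le> cmax"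
    and speed: "piecewise_constant_speed cmin cmax n x cs c"
    and sol: "helmholtz_solution \<omega> c g1 g2 u"
  shows "energy_norm \<omega> c u
    \<le> 2 * (1 + cmax / cmin) * (cmax / cmin) ^ n * sqrt ((norm g1)\<^sup>2 + (norm g2)\<^sup>2)"
proof -
  note speed_facts = speed_facts[OF speed cm(1)] and speed_ends = speed_ends[OF speed cm(1)]
  define \<rho> where "\<rho> = cmax / cmin"
  define G where "G = sqrt ((norm g1)\<^sup>2 + (norm g2)\<^sup>2)"
  let ?w = "weak_deriv \<Omega> u"
  have \<rho>: "1 \<le> \<rho>" and G: "0 \<le> G"
    using cm by (auto simp: \<rho>_def G_def)
  have u: "u \<in> H1_on \<Omega>"
    using sol by (simp add: helmholtz_solution_def)
  have iu: "integrable (lebesgue_on \<Omega>) u" and iw: "integrable (lebesgue_on \<Omega>) ?w"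
    using u by (auto intro!: integrable_L2_on weak_deriv_H1_on simp: H1_on_def)
  obtain K where uK: "AE t in lebesgue_on \<Omega>. u t = K + integral {-1..t} ?w"
    using H1_on_representative[OF u] by blast
  define U where "U t = K + integral {-1..t} ?w" for t
  \<comment> \<open>V is the right-hand side of the first-order identity with u replaced by its
    continuous version, hence the continuous version of the weak derivative.\<close>
  define V where "V t = - g1 - \<i> * of_real (\<omega> / c (-1)) * U (-1)
      - integral {-1..t} (\<lambda>t. of_real ((\<omega> / c t)\<^sup>2) * U t)" for t
  have contU: "continuous_on {-1..1} U"
    unfolding U_def by (intro continuous_intros continuous_primitive iw)
  have uU: "AE t in lebesgue_on \<Omega>. u t = U t"
    using uK by (simp add: U_def)
  have tr: "boundary_trace \<Omega> u p = U p" if "p \<in> {-1, 1}" for p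
    using that by (intro boundary_trace_\<Omega>_eqI contU uU) auto
  have f: "integrable (lebesgue_on \<Omega>) (\<lambda>t. of_real ((\<omega> / c t)\<^sup>2) * U t)"
    by (intro speed_factor_integrable[OF speed cm(1)] integrable_continuous_\<Omega> contU)
  have contV: "continuous_on {-1..1} V"
    unfolding V_def by (intro continuous_intros continuous_primitive f)
  have fU: "integral {-1..t} (\<lambda>t. of_real ((\<omega> / c t)\<^sup>2) * u t)
      = integral {-1..t} (\<lambda>t. of_real ((\<omega> / c t)\<^sup>2) * U t)" if "t \<in> \<Omega>" for t
  proof (rule integral_cong_AE_\<Omega>)
    show "AE t in lebesgue_on \<Omega>. of_real ((\<omega> / c t)\<^sup>2) * u t = of_real ((\<omega> / c t)\<^sup>2) * U t"
      using uU by eventually_elim simp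
  qed (use that in auto)
  have "AE t in lebesgue_on \<Omega>. t \<in> \<Omega>"
    by (rule AE_I2) simp
  then have wV: "AE t in lebesgue_on \<Omega>. ?w t = V t"
    using helmholtz_solution_weak_deriv[OF sol speed_factor_integrable[OF speed cm(1) iu]]
    by eventually_elim (simp only: fU V_def tr insertI1)
  \<comment> \<open>Replacing the weak derivative by the continuous V under the integral makes U
    continuously differentiable.\<close>
  have U_eq: "U t = K + integral {-1..t} V" if "t \<in> {-1..1}" for t
    unfolding U_def using that by (intro arg_cong2[of _ _ _ _ "(+)"] integral_cong_AE_\<Omega>[OF wV]) auto
  have derU: "(U has_vector_derivative V t) (at t within {-1..1})" if t: "t \<in> {-1..1}" for t
  proof (rule has_vector_derivative_transform[OF t])
    show "((\<lambda>t. K + integral {-1..t} V) has_vector_derivative V t) (at t within {-1..1})"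
      using has_vector_derivative_add[OF has_vector_derivative_const
          integral_has_vector_derivative[OF contV t]] by simp
  qed (simp add: U_eq)
  have V0: "V (-1) = - g1 - \<i> * of_real (\<omega> / cs 1) * U (-1)"
    by (simp add: V_def speed_ends)
  have V_eq: "V t = V (-1) - integral {-1..t} (\<lambda>t. of_real ((\<omega> / c t)\<^sup>2) * U t)" for t
    by (simp add: V_def)
  define E0 where "E0 = (norm (V (-1)))\<^sup>2 + (\<omega> / cs 1)\<^sup>2 * (norm (U (-1)))\<^sup>2"
  have cs1: "cmin \<le> cs 1" "cs 1 \<le> cmax" and csn: "cmin \<le> cs (n + 1)" "cs (n + 1) \<le> cmax"
    using speed_facts(2,3)[of 1] speed_facts(2,3)[of "n + 1"] by auto
  \<comment> \<open>The common lower bound for the impedances at both ends is m =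
    \<omega>/cmax.\<close>
  have "norm (U (-1)) \<le> G / (\<omega> / cmax)"
    unfolding G_def tr[of "-1", simplified, symmetric]
    by (rule helmholtz_boundary_estimate[OF sol])
      (use \<omega> cm cs1 csn in \<open>auto simp: speed_ends intro!: divide_left_mono\<close>)
  then have "\<omega> / cs 1 * norm (U (-1)) \<le> \<omega> / cmin * (G / (\<omega> / cmax))"
    using \<omega> cm cs1 by (intro mult_mono divide_left_mono) auto
  also have "\<dots> = \<rho> * G"
    using \<omega> by (simp add: \<rho>_def)
  finally have kU: "\<omega> / cs 1 * norm (U (-1)) \<le> \<rho> * G" .
  have "norm (V (-1)) \<le> norm g1 + \<omega> / cs 1 * norm (U (-1))"
    unfolding V0 using \<omega> cs1 cm
    by (intro order_trans[OF norm_triangle_ineq4]) (simp add: norm_mult norm_divide)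
  also have "\<dots> \<le> G + \<rho> * G"
    using kU by (intro add_mono) (auto simp: G_def)
  finally have V0_le: "norm (V (-1)) \<le> (1 + \<rho>) * G"
    by (simp add: algebra_simps)
  have "E0 = (norm (V (-1)))\<^sup>2 + (\<omega> / cs 1 * norm (U (-1)))\<^sup>2"
    by (simp add: E0_def power_mult_distrib power_divide)
  also have "\<dots> \<le> ((1 + \<rho>) * G)\<^sup>2 + (\<rho> * G)\<^sup>2"
    using V0_le kU \<omega> cs1 cm by (intro add_mono power_mono) auto
  also have "(\<rho> * G)\<^sup>2 \<le> ((1 + \<rho>) * G)\<^sup>2"
    using \<rho> G by (intro power_mono mult_right_mono) auto
  finally have E0: "E0 \<le> 2 * ((1 + \<rho>) * G)\<^sup>2"
    by simp
  have "E0 \<ge> 0"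
    by (simp add: E0_def)
  let ?B = "(\<rho>\<^sup>2) ^ n * E0"
  have "AE t in lebesgue_on \<Omega>. (norm (?w t))\<^sup>2 + (\<omega> / c t)\<^sup>2 * (norm (u t))\<^sup>2 \<le> ?B"
    using AE_speed_piece[OF speed cm(1)] uU wV
  proof eventually_elim
    case (elim t)
    then obtain j where j: "j \<in> {1..n+1}" "t \<in> {x (j - 1)<..<x j}"
      by blast
    have "(norm (V t))\<^sup>2 + (\<omega> / cs j)\<^sup>2 * (norm (U t))\<^sup>2 \<le> (\<rho>\<^sup>2) ^ (j - 1) * E0"
      unfolding \<rho>_def E0_def
      by (rule piecewise_energy_bound[OF speed cm(1) derU V_eq j(1)]) (use j in auto)
    also have "\<dots> \<le> ?B"
      using j(1) \<rho> \<open>E0 \<ge> 0\<close> by (intro mult_right_mono power_increasing) auto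
    finally show ?case
      using elim speed_facts(4)[OF j] by simp
  qed
  moreover have "integrable (lebesgue_on \<Omega>) (\<lambda>t. ?B)" 
    using finite_measure.integrable_const[OF finite_measure_lebesgue_on[OF lmeasurable_\<Omega>(1)]] .
  moreover have "0 \<le> ?B"
    using \<rho> \<open>E0 \<ge> 0\<close> by simp
  \<comment> \<open>Only the constant majorant has to be integrable; \<open>0 \<le> ?B\<close>
    covers the default value 0 of the left integral.\<close>
  ultimately have "(LINT t|lebesgue_on \<Omega>. (norm (?w t))\<^sup>2 + (\<omega> / c t)\<^sup>2 * (norm (u t))\<^sup>2)
      \<le> (LINT t|lebesgue_on \<Omega>. ?B)"
    by (intro integral_mono_AE') auto
  also have "\<dots> = 2 * ?B"
    by (simp add: measure_restrict_space)
  also have "\<dots> \<le> 2 * ((\<rho>\<^sup>2) ^ n * (2 * ((1 + \<rho>) * G)\<^sup>2))"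
    using E0 by (intro mult_left_mono) auto
  also have "\<dots> = (2 * (1 + \<rho>) * \<rho> ^ n * G)\<^sup>2"
    by (simp only: power_mult_distrib power_mult[symmetric] mult.commute[of 2 n]) simp
  finally have "energy_norm \<omega> c u \<le> sqrt ((2 * (1 + \<rho>) * \<rho> ^ n * G)\<^sup>2)"
    unfolding energy_norm_def by (rule real_sqrt_le_mono)
  also have "\<dots> = 2 * (1 + \<rho>) * \<rho> ^ n * G"
    using \<rho> G by simp
  finally show ?thesis
    by (simp add: \<rho>_def G_def)
qed

theorem proposition18:
  fixes cmin cmax q \<alpha> \<omega>0 :: real
  assumes "0 < cmin" and "cmin \<le> cmax"
    and "q = (cmax - cmin) / (cmax + cmin)"
    and "\<alpha> > 0" and "\<omega>0 > 0"
  shows "\<exists>\<alpha>q C. 0 < \<alpha>q \<and> \<alpha>q < 1 \<and> C > 0 \<and>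
    (\<forall>(\<omega>::real) (n::nat) (x::nat \<Rightarrow> real) (cs::nat \<Rightarrow> real) (c::real \<Rightarrow> real).
       \<omega> \<ge> \<omega>0 \<longrightarrow> piecewise_constant_speed cmin cmax n x cs c \<longrightarrow> real n \<le> \<alpha> * \<omega> \<longrightarrow>
       (\<exists>Cstab::real. Cstab \<le> C * \<alpha>q powr (- \<omega> / cmin) \<and>
          (\<forall>(g1::complex) (g2::complex) (u::real \<Rightarrow> complex).
             helmholtz_solution \<omega> c g1 g2 u \<longrightarrow>
             energy_norm \<omega> c u \<le> Cstab * sqrt ((norm g1)\<^sup>2 + (norm g2)\<^sup>2))))"
proof -
  define \<rho> where "\<rho> = cmax / cmin"
  have \<rho>: "1 \<le> \<rho>"
    using assms by (simp add: \<rho>_def)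
  \<comment> \<open>Chosen so that \<alpha>q to the power -\<omega>/cmin is (1 + \<rho>) to the
    power \<alpha> \<omega>, which dominates \<rho>^n. The base 1 + \<rho> instead of \<rho> keeps
    \<alpha>q below 1 even when cmin = cmax.\<close>
  define \<alpha>q where "\<alpha>q = (1 + \<rho>) powr (- (\<alpha> * cmin))"
  define C where "C = 2 * (1 + \<rho>)"
  have "0 < \<alpha>q" "C > 0"
    using \<rho> by (auto simp: \<alpha>q_def C_def)
  moreover have "\<alpha>q < 1"
    unfolding \<alpha>q_def using \<rho> assms by (intro powr_less_one) auto
  moreover have "\<exists>Cstab. Cstab \<le> C * \<alpha>q powr (- \<omega> / cmin) \<and>
      (\<forall>g1 g2 u. helmholtz_solution \<omega> c g1 g2 u \<longrightarrow>
         energy_norm \<omega> c u \<le> Cstab * sqrt ((norm g1)\<^sup>2 + (norm g2)\<^sup>2))"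
    if \<omega>: "\<omega> \<ge> \<omega>0" and speed: "piecewise_constant_speed cmin cmax n x cs c" and n: "real n \<le> \<alpha> * \<omega>"
    for \<omega> n x cs c
  proof (intro exI[of _ "C * \<rho> ^ n"] conjI allI impI)
    have "\<rho> ^ n \<le> (1 + \<rho>) ^ n"
      using \<rho> by (intro power_mono) auto
    also have "\<dots> = (1 + \<rho>) powr real n"
      using \<rho> by (simp add: powr_realpow)
    also have "\<dots> \<le> (1 + \<rho>) powr (\<alpha> * \<omega>)"
      using n \<rho> by (intro powr_mono) auto
    also have "\<dots> = \<alpha>q powr (- \<omega> / cmin)"
      using assms(1) by (simp add: \<alpha>q_def powr_powr)
    finally show "C * \<rho> ^ n \<le> C * \<alpha>q powr (- \<omega> / cmin)"
      using \<open>C > 0\<close> by simp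
    fix g1 g2 u
    assume "helmholtz_solution \<omega> c g1 g2 u"
    then show "energy_norm \<omega> c u \<le> C * \<rho> ^ n * sqrt ((norm g1)\<^sup>2 + (norm g2)\<^sup>2)"
      using helmholtz_stability[OF _ assms(1,2) speed] \<omega> assms(5) by (simp add: C_def \<rho>_def)
  qed
  ultimately show ?thesis by blast
qed

end
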